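(* Let $K$ be a countable field. Then $K$ is large if and only if $K$ admits a gt-henselian field topology.
   Context: A field $K$ is large if every smooth algebraic curve $C$ over $K$ with $C(K)\neq\varnothing$ has infinitely many $K$-rational points (equivalently: whenever $f(X,Y)\in K[X,Y]$ satisfies $f(0,0)=0\neq \frac{\partial f}{\partial Y}(0,0)$, the set $\{(a,b)\in K^2: f(a,b)=0\}$ is infinite). Field topologies are assumed to be Hausdorff and non-discrete. A field topology $\tau$ on $K$ is gt-henselian (generalized t-henselian) if for every $n\ge 2$ and every $\tau$-neighborhood $U$ of $-1$ there is a $\tau$-neighborhood $V$ of $0$ such that whenever $c_0,\ldots,c_{n-2}\in V$, the polynomial $X^n+X^{n-1}+c_{n-2}X^{n-2}+\cdots+c_1X+c_0$ has a root in $U$. (Equivalently, the implicit function theorem holds for polynomials with respect to $\tau$.) *)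

theory Defs
  imports "HOL-Analysis.T1_Spaces" "HOL-Computational_Algebra.Polynomial" "HOL-Library.Countable_Set"
begin

text \<open>
  Polynomials in \<open>K[X,Y]\<close> are represented as \<open>K[X][Y]\<close>, that is, as polynomials in \<open>Y\<close>
  with coefficients in \<open>K[X]\<close>. Hence \<^const>\<open>pderiv\<close> is the partial derivative with respect to \<open>Y\<close>.
\<close>

definition eval_XY :: "'a::comm_ring_1 poly poly \<Rightarrow> 'a \<Rightarrow> 'a \<Rightarrow> 'a" where
  "eval_XY f a b = poly (poly f [:b:]) a"

text \<open>
  Largeness of the field \<open>K = UNIV :: 'a set\<close>, phrased with plane curves that are smooth at the
  origin because \<open>\<partial>f/\<partial>Y\<close> does not vanish there.
\<close>

definition large_field :: "'a::field itself \<Rightarrow> bool" where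
  "large_field _ \<longleftrightarrow>
     (\<forall>f :: 'a poly poly. eval_XY f 0 0 = 0 \<and> eval_XY (pderiv f) 0 0 \<noteq> 0
        \<longrightarrow> infinite {(a, b). eval_XY f a b = 0})"

definition field_topology :: "'a::field topology \<Rightarrow> bool" where
  "field_topology \<tau> \<longleftrightarrow>
     topspace \<tau> = UNIV \<and>
     continuous_map (prod_topology \<tau> \<tau>) \<tau> (\<lambda>(x, y). x + y) \<and>
     continuous_map \<tau> \<tau> uminus \<and>
     continuous_map (prod_topology \<tau> \<tau>) \<tau> (\<lambda>(x, y). x * y) \<and>
     continuous_map (subtopology \<tau> (UNIV - {0})) \<tau> inverse \<and>
     Hausdorff_space \<tau> \<and>
     \<tau> \<noteq> discrete_topology UNIV"

definition is_nbhd :: "'a topology \<Rightarrow> 'a \<Rightarrow> 'a set \<Rightarrow> bool" where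
  "is_nbhd \<tau> x U \<longleftrightarrow> (\<exists>W. openin \<tau> W \<and> x \<in> W \<and> W \<subseteq> U)"

definition gt_henselian :: "'a::field topology \<Rightarrow> bool" where
  "gt_henselian \<tau> \<longleftrightarrow>
     (\<forall>n\<ge>2. \<forall>U. is_nbhd \<tau> (- 1) U \<longrightarrow>
        (\<exists>V. is_nbhd \<tau> 0 V \<and>
           (\<forall>c :: nat \<Rightarrow> 'a. (\<forall>i\<le>n - 2. c i \<in> V) \<longrightarrow>
              (\<exists>x\<in>U. poly (monom 1 n + monom 1 (n - 1) + (\<Sum>i\<le>n - 2. monom (c i) i)) x = 0))))"

end

theory Submission
  imports "Jordan_Normal_Form.Char_Poly" Defs "HOL-Computational_Algebra.Polynomial_FPS"
begin

text \<open>
  If \<open>K\<close> carries a gt-henselian topology and \<open>f(x, Y) = a\<^sub>0 + a\<^sub>1 Y + \<dots>\<close>, then the substitution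
  \<open>Y = a\<^sub>0 / (a\<^sub>1 w)\<close> turns \<open>f(x, Y) = 0\<close> into \<open>w\<^sup>n + w\<^sup>n\<^sup>-\<^sup>1 + \<dots> = 0\<close> with lower coefficients tending
  to \<open>0\<close> as \<open>x\<close> does, so there is a point above every small \<open>x\<close>.

  Conversely, a topology is built as an increasing union of finite approximations to a neighbourhood
  basis \<open>U\<^sub>0 \<supseteq> U\<^sub>1 \<supseteq> \<dots>\<close> of \<open>0\<close>, where field operations and simple roots \<open>-1 + y\<close> of the polynomials
  \<open>X\<^sup>n + X\<^sup>n\<^sup>-\<^sup>1 + \<dots>\<close> lead from level \<open>k + 1\<close> to level \<open>k\<close>. Since the elements of \<open>K\<close> are enumerated
  and act as scalars, the topology is Hausdorff as soon as \<open>1 \<notin> U\<^sub>0\<close>. To enlarge an approximation by a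
  nonzero element of a deep level, adjoin a variable \<open>t\<close> instead; Hensel's lemma in \<open>K[[t]]\<close> provides the
  roots, and setting \<open>t = 0\<close> gives back the old approximation, so \<open>1\<close> is still avoided. Only finitely
  many power series algebraic over \<open>K(t)\<close> occur. They generate a subfield \<open>K(t, z)\<close> of \<open>K((t))\<close>, where
  \<open>(t, z)\<close> parametrises a plane curve that is smooth at the origin. As \<open>K\<close> is large, the curve has a
  rational point at which finitely many prescribed nonzero functions are defined and nonzero;
  evaluation there specialises \<open>t\<close> and the power series to elements of \<open>K\<close>.
\<close>

hide_const (open) Module.smult
no_notation vec_index (infixl \<open>$\<close> 100)
unbundle fps_syntax

section \<open>Subrings\<close>

definition is_subring :: "'a::comm_ring_1 set \<Rightarrow> bool" where
  "is_subring R \<longleftrightarrow> 1 \<in> R \<and> (\<forall>x\<in>R. \<forall>y\<in>R. x - y \<in> R \<and> x * y \<in> R)"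

context
  fixes R :: "'a::comm_ring_1 set"
  assumes R: "is_subring R"
begin

lemma is_subring_1: "1 \<in> R"
  and is_subring_diff: "x \<in> R \<Longrightarrow> y \<in> R \<Longrightarrow> x - y \<in> R"
  and is_subring_mult: "x \<in> R \<Longrightarrow> y \<in> R \<Longrightarrow> x * y \<in> R"
  using R unfolding is_subring_def by blast+

lemma is_subring_0: "0 \<in> R"
  using is_subring_diff[OF is_subring_1 is_subring_1] by simp

lemma is_subring_uminus: "x \<in> R \<Longrightarrow> - x \<in> R"
  using is_subring_diff[OF is_subring_0] by simp

lemma is_subring_add: "x \<in> R \<Longrightarrow> y \<in> R \<Longrightarrow> x + y \<in> R"
  using is_subring_diff[of x "- y"] is_subring_uminus[of y] by simp

lemma is_subring_sum: "(\<And>i. i \<in> I \<Longrightarrow> f i \<in> R) \<Longrightarrow> sum f I \<in> R"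
  by (induction I rule: infinite_finite_induct) (auto intro: is_subring_0 is_subring_add)

lemma is_subring_power: "x \<in> R \<Longrightarrow> x ^ n \<in> R"
  by (induction n) (auto intro: is_subring_1 is_subring_mult)

lemma is_subring_of_nat: "of_nat n \<in> R"
  by (induction n) (auto intro: is_subring_0 is_subring_1 is_subring_add)

lemma is_subring_poly: "(\<And>i. coeff P i \<in> R) \<Longrightarrow> x \<in> R \<Longrightarrow> poly P x \<in> R"
  unfolding poly_altdef by (intro is_subring_sum is_subring_mult is_subring_power)

lemma is_subring_polys: "is_subring {P. \<forall>i. coeff P i \<in> R}"
  unfolding is_subring_def
  by (auto simp: coeff_mult intro: is_subring_0 is_subring_1 is_subring_diff is_subring_sum is_subring_mult)

end

lemma is_subring_coeff_pderiv:
  fixes R :: "'a::idom set"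
  shows "is_subring R \<Longrightarrow> (\<And>i. coeff P i \<in> R) \<Longrightarrow> coeff (pderiv P) i \<in> R"
  unfolding coeff_pderiv by (intro is_subring_mult is_subring_of_nat)

lemma is_subring_coeff_pcompose:
  fixes R :: "'a::comm_ring_1 set"
  assumes R: "is_subring R" and "\<And>i. coeff P i \<in> R" "\<And>i. coeff Q i \<in> R"
  shows "coeff (pcompose P Q) i \<in> R"
proof -
  have "poly (map_poly (\<lambda>a. [:a:]) P) Q \<in> {P. \<forall>i. coeff P i \<in> R}"
    using assms
    by (intro is_subring_poly is_subring_polys)
       (auto simp: coeff_map_poly coeff_pCons is_subring_0[OF R] split: nat.splits)
  then show ?thesis by (simp add: pcompose_altdef)
qed

lemma (in comm_ring_hom) is_subring_image:
  assumes "is_subring R"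
  shows "is_subring (hom ` R)"
  unfolding is_subring_def
proof (intro conjI ballI)
  show "1 \<in> hom ` R"
    using is_subring_1[OF assms] by (metis hom_one imageI)
  fix x y assume "x \<in> hom ` R" "y \<in> hom ` R"
  then obtain a b where "x = hom a" "y = hom b" "a \<in> R" "b \<in> R" by blast
  then show "x - y \<in> hom ` R" "x * y \<in> hom ` R"
    using is_subring_diff[OF assms] is_subring_mult[OF assms] by (auto simp flip: hom_minus hom_mult)
qed

section \<open>Algebraic elements\<close>

lemma linear_relation_exists:
  fixes v :: "nat \<Rightarrow> 'b \<Rightarrow> 'd::idom"
  assumes "finite B"
  obtains e k where "k \<le> card B" "e k \<noteq> 0" "\<And>b. b \<in> B \<Longrightarrow> (\<Sum>i\<le>card B. e i * v i b) = 0"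
proof -
  define n where "n = card B"
  obtain \<beta> where \<beta>: "bij_betw \<beta> {0..<n} B"
    using ex_bij_betw_nat_finite[OF assms] unfolding n_def by blast
  let ?row = "\<lambda>i. vec (Suc n) (\<lambda>j. v j (\<beta> i))"
  define A where "A = mat\<^sub>r (Suc n) (Suc n) (\<lambda>i. if i = n then 0\<^sub>v (Suc n) else ?row i)"
  have "det A = 0"
    unfolding A_def by (rule det_row_0) auto
  moreover have "A \<in> carrier_mat (Suc n) (Suc n)" by (simp add: A_def)
  ultimately obtain x where x: "x \<in> carrier_vec (Suc n)" "x \<noteq> 0\<^sub>v (Suc n)" "A *\<^sub>v x = 0\<^sub>v (Suc n)"
    using det_0_iff_vec_prod_zero by blast
  have relation: "(\<Sum>i\<le>n. vec_index x i * v i b) = 0" if "b \<in> B" for b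
  proof -
    obtain j where j: "j < n" "b = \<beta> j"
      using \<beta> \<open>b \<in> B\<close> by (auto simp: bij_betw_def)
    have "vec_index (A *\<^sub>v x) j = (\<Sum>i<Suc n. v i b * vec_index x i)"
      using j x(1) by (simp add: A_def scalar_prod_def lessThan_atLeast0)
    then show ?thesis
      using j(1) by (simp add: x(3) lessThan_Suc_atMost mult.commute)
  qed
  obtain k where "k < Suc n" "vec_index x k \<noteq> 0"
    using x(1,2) by (metis carrier_vecD eq_vecI index_zero_vec)
  then show ?thesis
    using that[of k "vec_index x"] relation by (simp add: n_def)
qed

locale idom_extension = inj_idom_hom hom for hom :: "'d::idom \<Rightarrow> 'e::idom"
begin

sublocale map_poly_hom: map_poly_inj_idom_hom hom ..

abbreviation eval :: "'d poly \<Rightarrow> 'e \<Rightarrow> 'e" where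
  "eval p x \<equiv> poly (map_poly hom p) x"

lemma eval_altdef:
  assumes "degree p \<le> n"
  shows "eval p x = (\<Sum>i\<le>n. hom (coeff p i) * x ^ i)"
proof -
  have "eval p x = poly (\<Sum>i\<le>n. monom (hom (coeff p i)) i) x"
    using assms poly_as_sum_of_monoms'[of "map_poly hom p" n] by simp
  then show ?thesis
    by (simp add: poly_sum poly_monom)
qed

lemma derivation_eval:
  assumes add: "\<And>x y. \<delta> (x + y) = \<delta> x + \<delta> y"
    and mult: "\<And>x y. \<delta> (x * y) = x * \<delta> y + \<delta> x * y"
    and hom: "\<And>a. \<delta> (hom a) = hom (d a)"
  shows "\<delta> (eval p x) = eval (map_poly d p) x + eval (pderiv p) x * \<delta> x"
proof -
  have d0: "d 0 = 0"
    using hom[of 0] add[of 0 0] by (metis add_cancel_left_left add_0 hom_0 hom_zero)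
  show ?thesis
  proof (induction p)
    case 0
    show ?case using hom[of 0] d0 by simp
  next
    case (pCons a p)
    have "\<delta> (eval (pCons a p) x) = hom (d a) + x * (eval (map_poly d p) x + eval (pderiv p) x * \<delta> x)
        + \<delta> x * eval p x"
      by (simp add: hom_distribs add mult hom pCons.IH)
    then show ?case
      by (simp add: Polynomial.map_poly_pCons d0 pderiv_pCons hom_distribs algebra_simps)
  qed
qed

definition algebraic_over :: "'e \<Rightarrow> bool" where
  "algebraic_over x \<longleftrightarrow> (\<exists>p. p \<noteq> 0 \<and> eval p x = 0)"

interpretation hom_module: Modules.module "\<lambda>a x. hom a * x"
  by unfold_locales (simp_all add: hom_distribs algebra_simps)

text \<open>The linear span of \<open>B\<close> over the fraction field of \<open>'d\<close>, written without denominators.\<close>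

definition frac_span :: "'e set \<Rightarrow> 'e set" where
  "frac_span B = {x. \<exists>m. m \<noteq> 0 \<and> hom m * x \<in> hom_module.span B}"

lemma span_subset_frac_span: "hom_module.span B \<subseteq> frac_span B"
  unfolding frac_span_def by (auto intro: exI[of _ 1])

lemma frac_span_divide:
  assumes "hom m * x \<in> frac_span B" "m \<noteq> 0"
  shows "x \<in> frac_span B"
proof -
  obtain n where "n \<noteq> 0" "hom (n * m) * x \<in> hom_module.span B"
    using assms(1) unfolding frac_span_def by auto
  then show ?thesis
    using assms(2) unfolding frac_span_def by (intro CollectI exI[of _ "n * m"]) simp
qed

lemma subspace_frac_span: "hom_module.subspace (frac_span B)"
proof (intro hom_module.subspaceI)
  show "0 \<in> frac_span B"
    using span_subset_frac_span hom_module.span_zero by blast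
next
  fix x y assume "x \<in> frac_span B" "y \<in> frac_span B"
  then obtain m n where mn: "m \<noteq> 0" "hom m * x \<in> hom_module.span B" "n \<noteq> 0" "hom n * y \<in> hom_module.span B"
    unfolding frac_span_def by blast
  have "hom (m * n) * (x + y) = hom n * (hom m * x) + hom m * (hom n * y)"
    by (simp add: hom_distribs algebra_simps)
  also have "\<dots> \<in> hom_module.span B"
    by (intro hom_module.span_add hom_module.span_scale mn)
  finally show "x + y \<in> frac_span B"
    using mn(1,3) unfolding frac_span_def by (intro CollectI exI[of _ "m * n"]) simp
next
  fix c x assume "x \<in> frac_span B"
  then obtain m where "m \<noteq> 0" "hom m * x \<in> hom_module.span B"
    unfolding frac_span_def by blast
  then show "hom c * x \<in> frac_span B"
    using hom_module.span_scale[of "hom m * x" B c]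
    unfolding frac_span_def by (intro CollectI exI[of _ m]) (simp add: mult.commute[of m c])
qed

lemma frac_span_times:
  assumes "x \<in> frac_span B" "\<And>b. b \<in> B \<Longrightarrow> b * y \<in> frac_span C"
  shows "x * y \<in> frac_span C"
proof -
  obtain m where m: "m \<noteq> 0" "hom m * x \<in> hom_module.span B"
    using assms(1) unfolding frac_span_def by blast
  have "hom_module.subspace {z. z * y \<in> frac_span C}"
    using subspace_frac_span[of C]
    unfolding hom_module.subspace_def by (auto simp: distrib_right mult.assoc)
  then have "hom_module.span B \<subseteq> {z. z * y \<in> frac_span C}"
    using assms(2) by (intro hom_module.span_minimal) auto
  with m(2) have "hom m * (x * y) \<in> frac_span C"
    by (auto simp: mult.assoc simp del: hom_module.scale_scale)
  then show ?thesis
    using m(1) by (rule frac_span_divide)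
qed

lemma algebraic_over_if_powers:
  assumes "finite B" "\<And>k. x ^ k \<in> frac_span B"
  shows "algebraic_over x"
proof -
  have "\<exists>m a. m \<noteq> 0 \<and> hom m * x ^ k = (\<Sum>b\<in>B. hom (a b) * b)" for k
    using assms(2)[of k] unfolding frac_span_def hom_module.span_finite[OF assms(1)] by blast
  then obtain m a where m: "\<And>k. m k \<noteq> 0" and a: "\<And>k. hom (m k) * x ^ k = (\<Sum>b\<in>B. hom (a k b) * b)"
    by metis
  obtain e k where e: "k \<le> card B" "e k \<noteq> 0" "\<And>b. b \<in> B \<Longrightarrow> (\<Sum>i\<le>card B. e i * a i b) = 0"
    using linear_relation_exists[OF assms(1)] by blast
  define p where "p = (\<Sum>i\<le>card B. monom (e i * m i) i)"
  have "coeff p k \<noteq> 0"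
    using e(1,2) m by (simp add: p_def coeff_sum)
  moreover have "eval p x = 0"
  proof -
    have "eval p x = (\<Sum>i\<le>card B. hom (e i) * (hom (m i) * x ^ i))"
      by (simp add: p_def hom_distribs poly_sum poly_monom mult.assoc
          del: hom_module.scale_scale)
    also have "\<dots> = (\<Sum>b\<in>B. hom (\<Sum>i\<le>card B. e i * a i b) * b)"
      unfolding a by (simp add: hom_distribs sum_distrib_left sum_distrib_right mult.assoc
          del: hom_module.scale_scale) (rule sum.swap)
    also have "\<dots> = 0"
      by (intro sum.neutral) (simp add: e(3))
    finally show ?thesis .
  qed
  ultimately show ?thesis
    unfolding algebraic_over_def by (intro exI[of _ p]) auto
qed

definition finite_rank_subring :: "'e set \<Rightarrow> bool" where
  "finite_rank_subring A \<longleftrightarrow> is_subring A \<and> range hom \<subseteq> A \<and> (\<exists>B. finite B \<and> A \<subseteq> frac_span B)"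

lemma algebraic_over_if_finite_rank:
  assumes "finite_rank_subring A" "x \<in> A"
  shows "algebraic_over x"
proof -
  obtain B where B: "finite B" "A \<subseteq> frac_span B"
    using assms(1) unfolding finite_rank_subring_def by blast
  have "is_subring A"
    using assms(1) by (simp add: finite_rank_subring_def)
  then have "x ^ k \<in> frac_span B" for k
    using is_subring_power assms(2) B(2) by blast
  with B(1) show ?thesis by (rule algebraic_over_if_powers)
qed

lemma finite_rank_subring_range_hom: "finite_rank_subring (range hom)"
proof -
  have "is_subring (range hom)"
    by (rule is_subring_image) (simp add: is_subring_def)
  moreover have "range hom \<subseteq> frac_span {1}"
    using span_subset_frac_span[of "{1}"] by (auto simp: hom_module.span_singleton)
  ultimately show ?thesis
    unfolding finite_rank_subring_def by blast
qed

definition adjoin :: "'e set \<Rightarrow> 'e \<Rightarrow> 'e set" where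
  "adjoin A r = (\<lambda>P. poly P r) ` {P. \<forall>i. coeff P i \<in> A}"

lemma adjoin_superset:
  assumes "is_subring A"
  shows "A \<subseteq> adjoin A r" "r \<in> adjoin A r"
proof -
  show "A \<subseteq> adjoin A r"
  proof
    fix x assume "x \<in> A"
    then show "x \<in> adjoin A r"
      unfolding adjoin_def
      by (intro image_eqI[of _ _ "[:x:]"]) (auto simp: coeff_pCons is_subring_0[OF assms] split: nat.splits)
  qed
  show "r \<in> adjoin A r"
    unfolding adjoin_def
    by (intro image_eqI[of _ _ "[:0, 1:]"])
       (auto simp: coeff_pCons is_subring_0[OF assms] is_subring_1[OF assms] split: nat.splits)
qed

lemma is_subring_adjoin:
  assumes "is_subring A"
  shows "is_subring (adjoin A r)"
  unfolding adjoin_def using is_subring_polys[OF assms] by (rule poly_hom.is_subring_image)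

lemma mult_power_in_frac_span:
  assumes A: "is_subring A" "A \<subseteq> frac_span B"
    and P: "\<And>i. coeff P i \<in> A" "lead_coeff P = hom m" "m \<noteq> 0" "poly P r = 0"
    and x: "x \<in> A"
  shows "x * r ^ k \<in> frac_span ((\<lambda>(b, j). b * r ^ j) ` (B \<times> {..<degree P}))"
    (is "_ \<in> frac_span ?C")
  using x
proof (induction k arbitrary: x rule: less_induct)
  case (less k)
  show ?case
  proof (cases "k < degree P")
    case True
    have "b * r ^ k \<in> frac_span ?C" if "b \<in> B" for b
      using True that span_subset_frac_span[of ?C] hom_module.span_superset[of ?C] by force
    then show ?thesis
      using less.prems A(2) by (intro frac_span_times[of x B]) auto
  next
    case False
    define d where "d = degree P"
    have "(\<Sum>i\<le>d. coeff P i * r ^ i) = 0"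
      using P(4) by (simp add: poly_altdef d_def)
    then have reduction: "hom m * r ^ d = (\<Sum>i<d. - coeff P i * r ^ i)"
      using P(2) by (simp add: d_def lessThan_Suc_atMost[symmetric] sum_negf eq_neg_iff_add_eq_0 add.commute)
    have "hom m * (x * r ^ k) = x * r ^ (k - d) * (hom m * r ^ d)"
      using False by (simp add: d_def mult_ac flip: power_add)
    also have "\<dots> = (\<Sum>i<d. (x * - coeff P i) * r ^ (k - d + i))"
      unfolding reduction by (simp add: sum_distrib_left power_add mult_ac)
    also have "\<dots> \<in> frac_span ?C"
      using False less.prems P(1) is_subring_mult[OF A(1)] is_subring_uminus[OF A(1)]
      by (intro hom_module.subspace_sum[OF subspace_frac_span] less.IH) (auto simp: d_def)
    finally show ?thesis
      using frac_span_divide P(3) by blast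
  qed
qed

lemma finite_rank_subring_adjoin:
  assumes A: "finite_rank_subring A"
    and P: "\<And>i. coeff P i \<in> A" "lead_coeff P = hom m" "m \<noteq> 0" "poly P r = 0"
  shows "finite_rank_subring (adjoin A r)"
proof -
  obtain B where B: "finite B" "A \<subseteq> frac_span B"
    using A unfolding finite_rank_subring_def by blast
  define C where "C = (\<lambda>(b, j). b * r ^ j) ` (B \<times> {..<degree P})"
  have subring: "is_subring A"
    using A by (simp add: finite_rank_subring_def)
  have "poly Q r \<in> frac_span C" if "\<And>i. coeff Q i \<in> A" for Q
    unfolding poly_altdef C_def
    by (intro hom_module.subspace_sum[OF subspace_frac_span] mult_power_in_frac_span[OF subring B(2) P] that)
  then have "adjoin A r \<subseteq> frac_span C"
    by (auto simp: adjoin_def)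
  moreover have "finite C"
    using B(1) by (simp add: C_def)
  moreover have "range hom \<subseteq> adjoin A r"
    using adjoin_superset(1)[OF subring] A by (auto simp: finite_rank_subring_def)
  ultimately show ?thesis
    using is_subring_adjoin[OF subring] unfolding finite_rank_subring_def by blast
qed

lemma finite_rank_subring_exists:
  assumes "finite S" "\<And>x. x \<in> S \<Longrightarrow> algebraic_over x"
  obtains A where "finite_rank_subring A" "S \<subseteq> A"
proof -
  have "\<exists>A. finite_rank_subring A \<and> S \<subseteq> A"
    using assms
  proof (induction S rule: finite_induct)
    case empty
    then show ?case using finite_rank_subring_range_hom by blast
  next
    case (insert x S)
    then obtain A where A: "finite_rank_subring A" "S \<subseteq> A" by auto
    then have subring: "is_subring A" "range hom \<subseteq> A"
      by (simp_all add: finite_rank_subring_def)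
    obtain p where p: "p \<noteq> 0" "eval p x = 0"
      using insert.prems[of x] by (auto simp: algebraic_over_def)
    have "finite_rank_subring (adjoin A x)"
      using p subring(2)
      by (intro finite_rank_subring_adjoin[OF A(1), of "map_poly hom p" "lead_coeff p"]) auto
    moreover have "insert x S \<subseteq> adjoin A x"
      using A(2) adjoin_superset[OF subring(1)] by blast
    ultimately show ?case by blast
  qed
  then show ?thesis using that by blast
qed

lemma algebraic_over_hom: "algebraic_over (hom a)"
  using algebraic_over_if_finite_rank finite_rank_subring_range_hom by blast

lemma is_subring_algebraic_over: "is_subring {x. algebraic_over x}"
  unfolding is_subring_def
proof (intro conjI ballI)
  show "1 \<in> {x. algebraic_over x}"
    using algebraic_over_hom[of 1] by simp
  fix x y assume "x \<in> {x. algebraic_over x}" "y \<in> {x. algebraic_over x}"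
  then obtain A where A: "finite_rank_subring A" "{x, y} \<subseteq> A"
    using finite_rank_subring_exists[of "{x, y}"] by auto
  then have "x - y \<in> A" "x * y \<in> A"
    by (auto simp: finite_rank_subring_def intro: is_subring_diff is_subring_mult)
  with A(1) show "x - y \<in> {x. algebraic_over x}" "x * y \<in> {x. algebraic_over x}"
    by (auto intro: algebraic_over_if_finite_rank)
qed

lemma algebraic_over_poly:
  "(\<And>i. algebraic_over (coeff P i)) \<Longrightarrow> algebraic_over x \<Longrightarrow> algebraic_over (poly P x)"
  using is_subring_poly[OF is_subring_algebraic_over] by blast

lemma algebraic_over_nonzero_relation:
  assumes "algebraic_over x" "x \<noteq> 0"
  obtains p where "coeff p 0 \<noteq> 0" "eval p x = 0"
proof -
  obtain p where p: "p \<noteq> 0" "eval p x = 0"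
    using assms(1) by (auto simp: algebraic_over_def)
  obtain q where q: "p = [:0, 1:] ^ order 0 p * q" "\<not> [:0, 1:] dvd q"
    using order_decomp[OF p(1), of 0] by auto
  have "x ^ order 0 p * eval q x = 0"
    using arg_cong[OF q(1), of "\<lambda>p. eval p x"] p(2) by (simp add: hom_distribs)
  moreover have "coeff q 0 \<noteq> 0"
    using q(2) poly_eq_0_iff_dvd[of q 0] by (simp add: poly_0_coeff_0)
  ultimately show ?thesis
    using that assms(2) by simp
qed

lemma algebraic_over_root:
  assumes "P \<noteq> 0" "\<And>i. algebraic_over (coeff P i)" "poly P r = 0"
  shows "algebraic_over r"
proof -
  obtain A where A: "finite_rank_subring A" "coeff P ` {..degree P} \<subseteq> A"
    by (rule finite_rank_subring_exists[of "coeff P ` {..degree P}"]) (use assms(2) in auto)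
  then have subring: "is_subring A" "range hom \<subseteq> A"
    by (simp_all add: finite_rank_subring_def)
  have coeff_P: "coeff P i \<in> A" for i
    using A(2) is_subring_0[OF subring(1)] by (cases "i \<le> degree P") (auto simp: coeff_eq_0)
  obtain q where q: "coeff q 0 \<noteq> 0" "eval q (lead_coeff P) = 0"
    using algebraic_over_nonzero_relation[OF assms(2)[of "degree P"]] assms(1) by auto
  obtain m q' where q': "q = pCons m q'" by (cases q)
  define u where "u = - eval q' (lead_coeff P)"
  have u: "u * lead_coeff P = hom m"
    using q(2) by (simp add: q' u_def hom_distribs add_eq_0_iff mult.commute)
  have "m \<noteq> 0" using q(1) by (simp add: q')
  then have "u \<noteq> 0" using u by auto
  moreover have "u \<in> A"
    unfolding u_def using subring(2) coeff_P
    by (intro is_subring_uminus is_subring_poly subring(1)) auto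
  ultimately have "finite_rank_subring (adjoin A r)"
    using assms(3) u coeff_P is_subring_mult[OF subring(1)] \<open>m \<noteq> 0\<close>
    by (intro finite_rank_subring_adjoin[OF A(1), of "smult u P" m]) auto
  then show ?thesis
    using adjoin_superset(2)[OF subring(1)] by (rule algebraic_over_if_finite_rank)
qed

end

section \<open>Inverse-Frobenius-linear maps\<close>

definition inv_frobenius_linear :: "nat \<Rightarrow> ('b::comm_semiring_1 \<Rightarrow> 'b) \<Rightarrow> bool" where
  "inv_frobenius_linear p \<theta> \<longleftrightarrow>
     (\<forall>a b. \<theta> (a + b) = \<theta> a + \<theta> b) \<and> (\<forall>x a. \<theta> (x ^ p * a) = x * \<theta> a)"

lemma inv_frobenius_linear_add: "inv_frobenius_linear p \<theta> \<Longrightarrow> \<theta> (a + b) = \<theta> a + \<theta> b"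
  and inv_frobenius_linear_mult: "inv_frobenius_linear p \<theta> \<Longrightarrow> \<theta> (x ^ p * a) = x * \<theta> a"
  by (simp_all add: inv_frobenius_linear_def)

lemma inv_frobenius_linear_0:
  assumes "inv_frobenius_linear p \<theta>" "p > 0"
  shows "\<theta> 0 = 0"
  using inv_frobenius_linear_mult[OF assms(1), of 0 0] assms(2) by (simp add: power_0_left)

lemma inv_frobenius_linear_sum:
  assumes "inv_frobenius_linear p \<theta>" "p > 0"
  shows "\<theta> (sum f A) = (\<Sum>x\<in>A. \<theta> (f x))"
  by (induction A rule: infinite_finite_induct)
     (simp_all add: inv_frobenius_linear_0[OF assms] inv_frobenius_linear_add[OF assms(1)])

lemma inv_frobenius_linear_exists:
  fixes a\<^sub>0 :: "'a::field"
  assumes "CHAR('a) > 0" "a\<^sub>0 \<noteq> 0"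
  obtains \<theta> :: "'a \<Rightarrow> 'a" where "inv_frobenius_linear CHAR('a) \<theta>" "\<theta> a\<^sub>0 \<noteq> 0"
proof -
  let ?p = "CHAR('a)"
  interpret vector_space_pair "\<lambda>x a :: 'a. x ^ ?p * a" "(*) :: 'a \<Rightarrow> 'a \<Rightarrow> 'a"
    using prime_CHAR_semidom[OF assms(1)] assms(1)
    by unfold_locales (auto simp: algebra_simps freshmans_dream power_mult_distrib)
  have "vs1.independent {a\<^sub>0}" using assms(2) by simp
  from linear_independent_extend[OF this, of "\<lambda>_. 1"] obtain \<theta>
    where \<theta>: "Vector_Spaces.linear (\<lambda>x a. x ^ ?p * a) (*) \<theta>" "\<theta> a\<^sub>0 = 1" by auto
  interpret \<theta>: Vector_Spaces.linear "\<lambda>x a. x ^ ?p * a" "(*)" \<theta> by (rule \<theta>(1))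
  show ?thesis
    using that[of \<theta>] \<theta>.add \<theta>.scale \<theta>(2) by (simp add: inv_frobenius_linear_def)
qed

lemma sum_multiples:
  fixes f :: "nat \<Rightarrow> 'b::comm_monoid_add"
  assumes "p > 0" "\<And>i. \<not> p dvd i \<Longrightarrow> f i = 0"
  shows "(\<Sum>i\<le>p * n. f i) = (\<Sum>i\<le>n. f (p * i))"
proof -
  have "(\<Sum>i\<le>n. f (p * i)) = (\<Sum>i\<in>(*) p ` {..n}. f i)"
    using assms(1) by (subst sum.reindex) (auto simp: inj_on_def)
  also have "\<dots> = (\<Sum>i\<le>p * n. f i)"
  proof (intro sum.mono_neutral_left ballI)
    fix i assume "i \<in> {..p * n} - (*) p ` {..n}"
    then have "\<not> p dvd i"
      using assms(1) by (auto elim!: dvdE)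
    then show "f i = 0" by (rule assms(2))
  qed auto
  finally show ?thesis ..
qed

lemma fps_nth_power_char:
  fixes y :: "'b::idom fps"
  assumes p: "p = CHAR('b)" "p > 0"
  shows "(y ^ p) $ j = (if p dvd j then (y $ (j div p)) ^ p else 0)"
proof (induction j arbitrary: y rule: less_induct)
  case (less j)
  have "prime p" using p by (simp add: prime_CHAR_semidom)
  have "y = fps_const (y $ 0) + fps_X * fps_shift 1 y"
    by (intro fps_ext) auto
  then have "y ^ p = (fps_const (y $ 0) + fps_X * fps_shift 1 y) ^ p" by simp
  also have "\<dots> = fps_const (y $ 0) ^ p + (fps_X * fps_shift 1 y) ^ p"
    using \<open>prime p\<close> p(1) by (simp only: freshmans_dream semiring_char_fps)
  also have "\<dots> = fps_const ((y $ 0) ^ p) + fps_X ^ p * fps_shift 1 y ^ p"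
    by (simp add: power_mult_distrib fps_const_power)
  finally have nth: "(y ^ p) $ j = (if j = 0 then (y $ 0) ^ p else 0) +
      (if j < p then 0 else (fps_shift 1 y ^ p) $ (j - p))"
    by (simp add: fps_X_power_mult_nth)
  show ?case
  proof (cases "j < p")
    case True
    then show ?thesis using p(2) nth by (cases "j = 0") auto
  next
    case False
    then have "j > 0" "p dvd (j - p) \<longleftrightarrow> p dvd j" "j div p = Suc ((j - p) div p)"
      using p(2) by (auto simp: le_div_geq dvd_minus_self)
    then show ?thesis using False p(2) by (simp add: nth less.IH)
  qed
qed

definition contract_fps :: "nat \<Rightarrow> ('b \<Rightarrow> 'b) \<Rightarrow> 'b fps \<Rightarrow> 'b fps" where
  "contract_fps p \<theta> x = Abs_fps (\<lambda>n. \<theta> (x $ (p * n)))"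

definition contract_poly :: "nat \<Rightarrow> ('b \<Rightarrow> 'b) \<Rightarrow> 'b::comm_monoid_add poly \<Rightarrow> 'b poly" where
  "contract_poly p \<theta> x = (\<Sum>j\<le>degree x. monom (\<theta> (coeff x (p * j))) j)"

lemma coeff_contract_poly:
  assumes "\<theta> 0 = 0" "p > 0"
  shows "coeff (contract_poly p \<theta> x) j = \<theta> (coeff x (p * j))"
proof -
  have "coeff (contract_poly p \<theta> x) j = (if j \<le> degree x then \<theta> (coeff x (p * j)) else 0)"
    by (simp add: contract_poly_def coeff_sum)
  moreover have "degree x < p * j" if "degree x < j"
    using that assms(2) by (metis Suc_leI less_le_trans mult_1 mult_le_mono1 One_nat_def)
  ultimately show ?thesis using assms(1) by (auto simp: coeff_eq_0)
qed

lemma degree_contract_poly_le: "degree (contract_poly p \<theta> x) \<le> degree x"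
  unfolding contract_poly_def by (intro degree_sum_le) (auto intro: order.trans[OF degree_monom_le])

lemma contract_fps_of_poly:
  assumes "\<theta> 0 = 0" "p > 0"
  shows "contract_fps p \<theta> (fps_of_poly x) = fps_of_poly (contract_poly p \<theta> x)"
  by (intro fps_ext) (simp add: contract_fps_def coeff_contract_poly[of \<theta>, OF assms])

lemma inv_frobenius_linear_contract_fps:
  fixes \<theta> :: "'b::idom \<Rightarrow> 'b"
  assumes \<theta>: "inv_frobenius_linear p \<theta>" and p: "p = CHAR('b)" "p > 0"
  shows "inv_frobenius_linear p (contract_fps p \<theta>)"
  unfolding inv_frobenius_linear_def
proof (intro conjI allI fps_ext)
  fix x y :: "'b fps" and n
  show "contract_fps p \<theta> (x + y) $ n = (contract_fps p \<theta> x + contract_fps p \<theta> y) $ n"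
    by (simp add: contract_fps_def inv_frobenius_linear_add[OF \<theta>])
  have "(y ^ p * x) $ (p * n) = (\<Sum>i\<le>p * n. (y ^ p) $ i * x $ (p * n - i))"
    by (simp add: fps_mult_nth atLeast0AtMost)
  also have "\<dots> = (\<Sum>i\<le>n. (y $ i) ^ p * x $ (p * (n - i)))"
    using p(2) by (subst sum_multiples) (auto simp: fps_nth_power_char[OF p] diff_mult_distrib2)
  finally have "\<theta> ((y ^ p * x) $ (p * n)) = (\<Sum>i\<le>n. y $ i * \<theta> (x $ (p * (n - i))))"
    by (simp only: inv_frobenius_linear_sum[OF \<theta> p(2)] inv_frobenius_linear_mult[OF \<theta>])
  then show "contract_fps p \<theta> (y ^ p * x) $ n = (y * contract_fps p \<theta> x) $ n"
    by (simp add: contract_fps_def fps_mult_nth[of y] atLeast0AtMost)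
qed

lemma inv_frobenius_linear_contract_poly:
  fixes \<theta> :: "'b::idom \<Rightarrow> 'b"
  assumes \<theta>: "inv_frobenius_linear p \<theta>" and p: "p = CHAR('b)" "p > 0"
  shows "inv_frobenius_linear p (contract_poly p \<theta>)"
proof -
  have fps: "fps_of_poly (contract_poly p \<theta> x) = contract_fps p \<theta> (fps_of_poly x)" for x
    using contract_fps_of_poly inv_frobenius_linear_0[OF \<theta> p(2)] p(2) by metis
  note contract = inv_frobenius_linear_contract_fps[OF \<theta> p]
  show ?thesis
    unfolding inv_frobenius_linear_def
  proof (intro conjI allI)
    fix x y :: "'b poly"
    have "fps_of_poly (contract_poly p \<theta> (x + y)) =
        fps_of_poly (contract_poly p \<theta> x + contract_poly p \<theta> y)"
      by (simp add: fps fps_of_poly_add inv_frobenius_linear_add[OF contract])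
    then show "contract_poly p \<theta> (x + y) = contract_poly p \<theta> x + contract_poly p \<theta> y"
      by (simp add: fps_of_poly_eq_iff)
    have "fps_of_poly (contract_poly p \<theta> (y ^ p * x)) = fps_of_poly (y * contract_poly p \<theta> x)"
      by (simp add: fps fps_of_poly_mult fps_of_poly_power inv_frobenius_linear_mult[OF contract])
    then show "contract_poly p \<theta> (y ^ p * x) = y * contract_poly p \<theta> x"
      by (simp add: fps_of_poly_eq_iff)
  qed
qed

lemma contract_poly_map_poly:
  assumes "\<And>a. \<theta>' (h a) = h (\<theta> a)" "h 0 = 0" "\<theta> 0 = 0" "p > 0"
  shows "contract_poly p \<theta>' (map_poly h q) = map_poly h (contract_poly p \<theta> q)"
proof -
  have "\<theta>' 0 = 0" using assms(1)[of 0] assms(2,3) by simp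
  then show ?thesis
    using assms by (intro poly_eqI) (simp add: coeff_contract_poly coeff_map_poly)
qed

lemma (in idom_extension) eval_contract_poly:
  assumes \<theta>: "inv_frobenius_linear p \<theta>" "p > 0" and hom: "\<And>a. \<theta> (hom a) = hom (\<eta> a)"
    and q: "\<And>k. \<not> p dvd k \<Longrightarrow> coeff q k = 0"
  shows "eval (contract_poly p \<eta> q) x = \<theta> (eval q x)"
proof -
  define n where "n = degree q"
  have "\<eta> 0 = 0"
    using hom[of 0] inv_frobenius_linear_0[OF \<theta>] by simp
  have "eval q x = (\<Sum>k\<le>p * n. hom (coeff q k) * x ^ k)"
    using \<theta>(2) by (intro eval_altdef) (simp add: n_def)
  also have "\<dots> = (\<Sum>k\<le>n. hom (coeff q (p * k)) * x ^ (p * k))"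
    using \<theta>(2) q by (intro sum_multiples) auto
  also have "\<dots> = (\<Sum>k\<le>n. (x ^ k) ^ p * hom (coeff q (p * k)))"
    by (simp add: mult.commute flip: power_mult)
  finally have "\<theta> (eval q x) = (\<Sum>k\<le>n. hom (\<eta> (coeff q (p * k))) * x ^ k)"
    by (simp add: inv_frobenius_linear_sum[OF \<theta>] inv_frobenius_linear_mult[OF \<theta>(1)] hom mult.commute)
  then show ?thesis
    using eval_altdef[OF degree_contract_poly_le] \<open>\<eta> 0 = 0\<close> \<theta>(2)
    by (simp add: coeff_contract_poly n_def)
qed

section \<open>Separability and primitive elements\<close>

interpretation series: idom_extension "fps_of_poly :: 'a::field poly \<Rightarrow> 'a fps"
  by unfold_locales (simp_all add: fps_of_poly_add fps_of_poly_mult fps_of_poly_eq_iff[of _ 0, simplified])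

interpretation series_poly: idom_extension "map_poly fps_of_poly :: 'a::field poly poly \<Rightarrow> 'a fps poly"
  by unfold_locales

text \<open>
  For \<open>f \<in> K[t][Y]\<close> and \<open>w \<in> K[[t]]\<close>, \<open>series.eval f w\<close> is \<open>f(t, w)\<close>; for \<open>\<chi> \<in> K[t][c][Y]\<close> and
  \<open>W \<in> K[[t]][c]\<close>, \<open>series_poly.eval \<chi> W\<close> is \<open>\<chi>(t, c, W)\<close>.
\<close>

definition total_degree_le :: "'a::zero poly poly poly \<Rightarrow> nat \<Rightarrow> bool" where
  "total_degree_le \<chi> N \<longleftrightarrow> (\<forall>k l i. coeff (coeff (coeff \<chi> k) l) i \<noteq> 0 \<longrightarrow> k + l + i \<le> N)"

lemma total_degree_le_exists: "\<exists>N. total_degree_le \<chi> N"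
proof -
  let ?f = "\<lambda>k l i. coeff (coeff (coeff \<chi> k) l) i"
  let ?M = "Max ((\<lambda>k. degree (coeff \<chi> k)) ` {..degree \<chi>})"
  let ?R = "Max ((\<lambda>(k, l). degree (coeff (coeff \<chi> k) l)) ` ({..degree \<chi>} \<times> {..?M}))"
  have "k + l + i \<le> degree \<chi> + ?M + ?R" if "?f k l i \<noteq> 0" for k l i
  proof -
    have k: "k \<le> degree \<chi>" using that by (auto intro: le_degree)
    have "l \<le> degree (coeff \<chi> k)" using that by (auto intro: le_degree)
    also have "\<dots> \<le> ?M" using k by (intro Max_ge) auto
    finally have l: "l \<le> ?M" .
    have "i \<le> degree (coeff (coeff \<chi> k) l)" using that by (auto intro: le_degree)
    also have "\<dots> \<le> ?R" using k l by (intro Max_ge) auto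
    finally show ?thesis using k l by linarith
  qed
  then show ?thesis unfolding total_degree_le_def by blast
qed

context
  fixes \<chi> :: "'a::field poly poly poly"
begin

abbreviation partial_Y :: "'a poly poly poly" where "partial_Y \<equiv> pderiv \<chi>"
abbreviation partial_c :: "'a poly poly poly" where "partial_c \<equiv> map_poly pderiv \<chi>"
abbreviation partial_t :: "'a poly poly poly" where "partial_t \<equiv> map_poly (map_poly pderiv) \<chi>"

lemma coeff_partials:
  "coeff (coeff (coeff partial_Y k) l) i = of_nat (Suc k) * coeff (coeff (coeff \<chi> (Suc k)) l) i"
  "coeff (coeff (coeff partial_c k) l) i = of_nat (Suc l) * coeff (coeff (coeff \<chi> k) (Suc l)) i"
  "coeff (coeff (coeff partial_t k) l) i = of_nat (Suc i) * coeff (coeff (coeff \<chi> k) l) (Suc i)"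
  by (simp_all add: coeff_pderiv coeff_map_poly of_nat_poly del: of_nat_Suc)

lemma total_degree_le_partials:
  assumes "total_degree_le \<chi> N" "N > 0"
  shows "total_degree_le partial_Y (N - 1)" "total_degree_le partial_c (N - 1)"
    "total_degree_le partial_t (N - 1)"
  using assms unfolding total_degree_le_def coeff_partials
  by (fastforce simp del: of_nat_Suc)+

lemma char_dvd_exponents:
  assumes "partial_Y = 0" "partial_c = 0" "partial_t = 0" "coeff (coeff (coeff \<chi> k) l) i \<noteq> 0"
  shows "CHAR('a) dvd k" "CHAR('a) dvd l" "CHAR('a) dvd i"
proof -
  have "of_nat k * coeff (coeff (coeff \<chi> k) l) i = 0"
    using coeff_partials(1)[of "k - 1" l i] assms(1) by (cases k) simp_all
  moreover have "of_nat l * coeff (coeff (coeff \<chi> k) l) i = 0"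
    using coeff_partials(2)[of k "l - 1" i] assms(2) by (cases l) simp_all
  moreover have "of_nat i * coeff (coeff (coeff \<chi> k) l) i = 0"
    using coeff_partials(3)[of k l "i - 1"] assms(3) by (cases i) simp_all
  ultimately show "CHAR('a) dvd k" "CHAR('a) dvd l" "CHAR('a) dvd i"
    using assms(4) by (simp_all add: of_nat_eq_0_iff_char_dvd)
qed

lemma pderiv_series_poly_eval:
  "pderiv (series_poly.eval \<chi> W) = series_poly.eval partial_c W + series_poly.eval partial_Y W * pderiv W"
  by (rule series_poly.derivation_eval) (auto simp: pderiv_add pderiv_mult series.map_poly_pderiv)

lemma fps_deriv_series_poly_eval:
  "map_poly fps_deriv (series_poly.eval \<chi> W) =
     series_poly.eval partial_t W + series_poly.eval partial_Y W * map_poly fps_deriv W"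
proof (rule series_poly.derivation_eval)
  fix x y :: "'a fps poly" and q :: "'a poly poly"
  show "map_poly fps_deriv (x + y) = map_poly fps_deriv x + map_poly fps_deriv y"
    by (simp add: poly_eq_iff coeff_map_poly)
  show "map_poly fps_deriv (x * y) = x * map_poly fps_deriv y + map_poly fps_deriv x * y"
    by (intro poly_eqI) (simp add: coeff_map_poly coeff_mult fps_deriv_sum sum.distrib)
  show "map_poly fps_deriv (map_poly fps_of_poly q) = map_poly fps_of_poly (map_poly pderiv q)"
    by (simp add: poly_eq_iff coeff_map_poly fps_of_poly_pderiv)
qed

lemma partials_are_relations:
  assumes "series_poly.eval \<chi> W = 0" "series_poly.eval partial_Y W = 0"
  shows "series_poly.eval partial_c W = 0" "series_poly.eval partial_t W = 0"
  using pderiv_series_poly_eval[of W] fps_deriv_series_poly_eval[of W] by (simp_all add: assms)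

lemma contracted_relation:
  assumes \<theta>: "inv_frobenius_linear p \<theta>" and p: "p = CHAR('a)" "p > 0"
    and dvd: "\<And>k l i. coeff (coeff (coeff \<chi> k) l) i \<noteq> 0 \<Longrightarrow> p dvd k"
    and \<chi>: "series_poly.eval \<chi> W = 0" "total_degree_le \<chi> N"
  obtains \<xi> where "series_poly.eval \<xi> W = 0" "total_degree_le \<xi> (N div p)"
    "\<And>k l i. coeff (coeff (coeff \<xi> k) l) i = \<theta> (coeff (coeff (coeff \<chi> (p * k)) (p * l)) (p * i))"
proof -
  have \<theta>0: "\<theta> 0 = 0" using inv_frobenius_linear_0[OF \<theta> p(2)] .
  have [simp]: "contract_poly p \<theta> 0 = 0" "contract_poly p (contract_poly p \<theta>) 0 = 0"
    "contract_fps p \<theta> 0 = 0"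
    by (simp_all add: contract_poly_def contract_fps_def \<theta>0 fps_eq_iff)
  define \<xi> where "\<xi> = contract_poly p (contract_poly p (contract_poly p \<theta>)) \<chi>"
  have coeff_\<xi>: "coeff (coeff (coeff \<xi> k) l) i = \<theta> (coeff (coeff (coeff \<chi> (p * k)) (p * l)) (p * i))" for k l i
    by (simp add: \<xi>_def coeff_contract_poly \<theta>0 p(2))
  have "series_poly.eval \<xi> W = contract_poly p (contract_fps p \<theta>) (series_poly.eval \<chi> W)"
    unfolding \<xi>_def
  proof (rule series_poly.eval_contract_poly)
    show "inv_frobenius_linear p (contract_poly p (contract_fps p \<theta>))"
      using \<theta> p by (intro inv_frobenius_linear_contract_poly inv_frobenius_linear_contract_fps) simp_all
    show "contract_poly p (contract_fps p \<theta>) (map_poly fps_of_poly q) =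
        map_poly fps_of_poly (contract_poly p (contract_poly p \<theta>) q)" for q
      using \<theta>0 p(2) by (intro contract_poly_map_poly contract_fps_of_poly) simp_all
    show "coeff \<chi> k = 0" if "\<not> p dvd k" for k
      using dvd that by (intro poly_eqI) force
  qed (fact p(2))
  then have "series_poly.eval \<xi> W = 0"
    using \<chi>(1) by (simp add: contract_poly_def)
  moreover have "total_degree_le \<xi> (N div p)"
    unfolding total_degree_le_def coeff_\<xi>
  proof (intro allI impI)
    fix k l i assume "\<theta> (coeff (coeff (coeff \<chi> (p * k)) (p * l)) (p * i)) \<noteq> 0"
    then have "p * k + p * l + p * i \<le> N"
      using \<chi>(2) \<theta>0 unfolding total_degree_le_def by metis
    then show "k + l + i \<le> N div p"
      using p(2) by (simp add: less_eq_div_iff_mult_less_eq algebra_simps)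
  qed
  ultimately show ?thesis using that coeff_\<xi> by blast
qed

lemma relation_not_const:
  assumes "\<chi> \<noteq> 0" "series_poly.eval \<chi> W = 0"
  shows "\<not> total_degree_le \<chi> 0"
proof
  assume const: "total_degree_le \<chi> 0"
  have "coeff \<chi> k = 0" if "k > 0" for k
    using const that unfolding total_degree_le_def by (intro poly_eqI) force
  then have "\<chi> = [:coeff \<chi> 0:]"
    by (intro poly_eqI) (simp add: coeff_pCons split: nat.splits)
  then obtain q where "\<chi> = [:q:]" by blast
  with assms show False by simp
qed

lemma smaller_relation_if_partials_vanish:
  assumes partials: "partial_Y = 0" "partial_c = 0" "partial_t = 0"
    and \<chi>: "\<chi> \<noteq> 0" "series_poly.eval \<chi> W = 0" "total_degree_le \<chi> N"
  obtains \<xi> M where "\<xi> \<noteq> 0" "series_poly.eval \<xi> W = 0" "total_degree_le \<xi> M" "M < N"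
proof -
  note char_dvd = char_dvd_exponents[OF partials]
  note nonconst = relation_not_const[OF \<chi>(1,2)]
  have "N > 0" using \<chi>(3) nonconst by (cases N) auto
  have "CHAR('a) > 0"
  proof (rule ccontr)
    assume "\<not> ?thesis"
    with char_dvd have "total_degree_le \<chi> 0"
      by (auto simp: total_degree_le_def)
    with nonconst show False by blast
  qed
  then have "prime CHAR('a)" by (rule prime_CHAR_semidom)
  obtain k l i where kli: "coeff (coeff (coeff \<chi> k) l) i \<noteq> 0"
    using \<chi>(1) by (auto simp: poly_eq_iff)
  obtain \<theta> :: "'a \<Rightarrow> 'a" where \<theta>: "inv_frobenius_linear CHAR('a) \<theta>"
    "\<theta> (coeff (coeff (coeff \<chi> k) l) i) \<noteq> 0"
    using inv_frobenius_linear_exists[OF \<open>CHAR('a) > 0\<close> kli] by blast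
  obtain \<xi> where \<xi>: "series_poly.eval \<xi> W = 0" "total_degree_le \<xi> (N div CHAR('a))"
    "\<And>k l i. coeff (coeff (coeff \<xi> k) l) i =
      \<theta> (coeff (coeff (coeff \<chi> (CHAR('a) * k)) (CHAR('a) * l)) (CHAR('a) * i))"
    by (rule contracted_relation[OF \<theta>(1) refl \<open>CHAR('a) > 0\<close> char_dvd(1) \<chi>(2,3)]) blast+
  have "\<xi> \<noteq> 0"
    using \<xi>(3)[of "k div CHAR('a)" "l div CHAR('a)" "i div CHAR('a)"] \<theta>(2) char_dvd[OF kli] by auto
  moreover have "N div CHAR('a) < N"
    using \<open>N > 0\<close> prime_gt_1_nat[OF \<open>prime CHAR('a)\<close>] by simp
  ultimately show ?thesis using that \<xi>(1,2) by blast
qed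

end

text \<open>
  A relation of minimal total degree is separable: otherwise all its partial derivatives vanish, so it
  is a polynomial in \<open>p\<close>-th powers, and a \<open>p\<close>-th root of it, taken after applying an inverse-Frobenius
  linear functional to the coefficients, is a smaller relation.
\<close>

lemma separable_relation_exists:
  fixes W :: "'a::field fps poly"
  assumes "series_poly.algebraic_over W"
  obtains \<chi> where "series_poly.eval \<chi> W = 0" "series_poly.eval (pderiv \<chi>) W \<noteq> 0"
proof -
  define P where "P N \<longleftrightarrow> (\<exists>\<chi>. \<chi> \<noteq> 0 \<and> series_poly.eval \<chi> W = 0 \<and> total_degree_le \<chi> N)" for N
  have "\<exists>N. P N"
    using assms total_degree_le_exists unfolding P_def series_poly.algebraic_over_def by blast
  then obtain N where "P N" and least: "\<And>M. M < N \<Longrightarrow> \<not> P M"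
    using exists_least_iff[of P] by auto
  then obtain \<chi> where \<chi>: "\<chi> \<noteq> 0" "series_poly.eval \<chi> W = 0" "total_degree_le \<chi> N"
    by (auto simp: P_def)
  have minimal: "\<xi> = 0" if "series_poly.eval \<xi> W = 0" "total_degree_le \<xi> M" "M < N" for \<xi> M
    using least[OF that(3)] that(1,2) by (auto simp: P_def)
  have "N > 0" using \<chi>(3) relation_not_const[OF \<chi>(1,2)] by (cases N) auto
  have "series_poly.eval (pderiv \<chi>) W \<noteq> 0"
  proof
    assume inseparable: "series_poly.eval (pderiv \<chi>) W = 0"
    note relations = inseparable partials_are_relations[OF \<chi>(2) inseparable]
    note degrees = total_degree_le_partials[OF \<chi>(3) \<open>N > 0\<close>]
    have "partial_Y \<chi> = 0" "partial_c \<chi> = 0" "partial_t \<chi> = 0"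
      using minimal[OF relations(1) degrees(1)] minimal[OF relations(2) degrees(2)]
        minimal[OF relations(3) degrees(3)] \<open>N > 0\<close> by simp_all
    then obtain \<xi> M where "\<xi> \<noteq> 0" "series_poly.eval \<xi> W = 0" "total_degree_le \<xi> M" "M < N"
      using smaller_relation_if_partials_vanish[OF _ _ _ \<chi>] by blast
    then show False using minimal by blast
  qed
  with \<chi>(2) that show ?thesis by blast
qed

context idom_extension
begin

definition is_quotient :: "'e \<Rightarrow> 'e \<Rightarrow> 'd poly \<Rightarrow> 'd poly \<Rightarrow> bool" where
  "is_quotient w \<alpha> h q \<longleftrightarrow> eval q w * \<alpha> = eval h w"

lemma is_quotient_diff:
  assumes "is_quotient w \<alpha> h q" "is_quotient w \<beta> h' q'"
  shows "is_quotient w (\<alpha> - \<beta>) (q' * h - q * h') (q * q')"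
proof -
  have "eval (q * q') w * (\<alpha> - \<beta>) = eval q' w * (eval q w * \<alpha>) - eval q w * (eval q' w * \<beta>)"
    by (simp add: hom_distribs algebra_simps)
  also have "\<dots> = eval (q' * h - q * h') w"
    using assms unfolding is_quotient_def by (simp add: hom_distribs)
  finally show ?thesis unfolding is_quotient_def .
qed

lemma is_quotient_mult:
  assumes "is_quotient w \<alpha> h q" "is_quotient w \<beta> h' q'"
  shows "is_quotient w (\<alpha> * \<beta>) (h * h') (q * q')"
proof -
  have "eval (q * q') w * (\<alpha> * \<beta>) = (eval q w * \<alpha>) * (eval q' w * \<beta>)"
    by (simp add: hom_distribs algebra_simps)
  also have "\<dots> = eval (h * h') w"
    using assms unfolding is_quotient_def by (simp add: hom_distribs)
  finally show ?thesis unfolding is_quotient_def .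
qed

definition rational_over :: "'e \<Rightarrow> 'e set" where
  "rational_over w = {\<alpha>. \<exists>h q. eval q w \<noteq> 0 \<and> is_quotient w \<alpha> h q}"

lemma rational_overI: "eval q w \<noteq> 0 \<Longrightarrow> eval q w * \<alpha> = eval h w \<Longrightarrow> \<alpha> \<in> rational_over w"
  unfolding rational_over_def is_quotient_def by blast

lemma rational_over_linear: "eval q w \<noteq> 0 \<Longrightarrow> eval h w + eval q w * \<alpha> = 0 \<Longrightarrow> \<alpha> \<in> rational_over w"
  by (rule rational_overI[of q _ _ "- h"]) (simp_all add: hom_distribs eq_neg_iff_add_eq_0 add.commute)

lemma rational_over_eval_self: "eval h w \<in> rational_over w"
  by (rule rational_overI[of 1]) auto

lemma is_subring_rational_over: "is_subring (rational_over w)"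
  unfolding is_subring_def
proof (intro conjI ballI)
  show "1 \<in> rational_over w"
    using rational_over_eval_self[of 1] by simp
  fix x y assume "x \<in> rational_over w" "y \<in> rational_over w"
  then obtain h q h' q' where quotients: "eval q w \<noteq> 0" "is_quotient w x h q"
    "eval q' w \<noteq> 0" "is_quotient w y h' q'"
    unfolding rational_over_def by blast
  then have "eval (q * q') w \<noteq> 0"
    by (simp add: hom_distribs)
  then show "x - y \<in> rational_over w" "x * y \<in> rational_over w"
    using is_quotient_diff is_quotient_mult quotients(2,4) unfolding rational_over_def by blast+
qed

lemma rational_over_divide:
  assumes "x \<in> rational_over w" "y \<in> rational_over w" "x \<noteq> 0" "x * u = y"
  shows "u \<in> rational_over w"
proof -
  obtain h q h' q' where quotients: "eval q w \<noteq> 0" "eval q w * x = eval h w"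
    "eval q' w \<noteq> 0" "eval q' w * y = eval h' w"
    using assms unfolding rational_over_def is_quotient_def by blast
  have "eval (h * q') w = eval q w * x * eval q' w"
    by (simp add: hom_distribs quotients)
  then have "eval (h * q') w \<noteq> 0" "eval (h * q') w * u = eval q w * (eval q' w * (x * u))"
    using quotients(1,3) assms(3) by (simp_all add: mult_ac)
  then show ?thesis
    using assms(4) quotients(4) by (intro rational_overI[of "h * q'" w u "q * h'"]) (simp_all add: hom_distribs)
qed

lemma rational_over_eval: "z \<in> rational_over w \<Longrightarrow> eval p z \<in> rational_over w"
  using rational_over_eval_self[of "[:_:]" w]
  by (intro is_subring_poly is_subring_rational_over) (simp_all add: hom_distribs)

lemma rational_over_trans:
  assumes "\<alpha> \<in> rational_over z" "z \<in> rational_over w"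
  shows "\<alpha> \<in> rational_over w"
proof -
  obtain q h where "eval q z \<noteq> 0" "eval q z * \<alpha> = eval h z"
    using assms(1) unfolding rational_over_def is_quotient_def by blast
  then show ?thesis
    using rational_over_divide rational_over_eval[OF assms(2)] by blast
qed

end

lemma series_poly_algebraic_const:
  assumes "series.algebraic_over z"
  shows "series_poly.algebraic_over [:z:]"
proof -
  obtain f where f: "f \<noteq> 0" "series.eval f z = 0"
    using assms by (auto simp: series.algebraic_over_def)
  have "series_poly.eval (map_poly (\<lambda>r. [:r:]) p) [:z:] = [:series.eval p z:]" for p
    by (induction p) (simp_all add: map_poly_pCons hom_distribs mult.commute)
  then show ?thesis
    using f unfolding series_poly.algebraic_over_def
    by (intro exI[of _ "map_poly (\<lambda>r. [:r:]) f"]) (simp add: map_poly_eq_0_iff)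
qed

lemma poly_eval_specialize:
  "poly (series_poly.eval \<chi> W) (fps_const c) =
     series.eval (map_poly (\<lambda>q. poly q [:c:]) \<chi>) (poly W (fps_const c))"
proof -
  have "poly (map_poly fps_of_poly q) (fps_const c) = fps_of_poly (poly q [:c:])" for q
    using series.poly_map_poly[of q "[:c:]"] by (simp add: fps_of_poly_const)
  then show ?thesis
    by (induction \<chi>) (simp_all add: map_poly_pCons hom_distribs)
qed

lemma poly_fps_const_nonzero:
  fixes P :: "'a::field fps poly"
  assumes "infinite (UNIV :: 'a set)" "P \<noteq> 0"
  obtains c where "poly P (fps_const c) \<noteq> 0"
proof -
  have "infinite (range (fps_const :: 'a \<Rightarrow> 'a fps))"
    using assms(1) by (subst finite_image_iff) (auto simp: inj_on_def)
  then have "\<not> range fps_const \<subseteq> {x. poly P x = 0}"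
    using poly_roots_finite[OF assms(2)] finite_subset by blast
  then show ?thesis using that by blast
qed

text \<open>
  Differentiating a relation \<open>\<chi>(t, c, z + c r) = 0\<close> with respect to the indeterminate \<open>c\<close> expresses
  \<open>r\<close> rationally in \<open>z + c r\<close>; then \<open>c\<close> is specialised to a constant.
\<close>

lemma primitive_element:
  fixes z r :: "'a::field fps"
  assumes "infinite (UNIV :: 'a set)" "series.algebraic_over z" "series.algebraic_over r"
  obtains w f where "series.eval f w = 0" "series.eval (pderiv f) w \<noteq> 0"
    "z \<in> series.rational_over w" "r \<in> series.rational_over w"
proof -
  define W where "W = [:z, r:]"
  have "[:z:] + map_poly fps_of_poly [:0, 1:] * [:r:] \<in> {x. series_poly.algebraic_over x}"
    using assms(2,3)
    by (intro is_subring_add is_subring_mult series_poly.is_subring_algebraic_over CollectI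
        series_poly_algebraic_const series_poly.algebraic_over_hom)
  then have "series_poly.algebraic_over W"
    by (simp add: W_def)
  then obtain \<chi> where \<chi>: "series_poly.eval \<chi> W = 0" "series_poly.eval (pderiv \<chi>) W \<noteq> 0"
    by (rule separable_relation_exists)
  have W': "pderiv W = [:r:]" by (simp add: W_def pderiv_pCons)
  have deriv: "series_poly.eval (map_poly pderiv \<chi>) W + series_poly.eval (pderiv \<chi>) W * [:r:] = 0"
    using pderiv_series_poly_eval[of \<chi> W] by (simp add: \<chi>(1) W')
  obtain c where c: "poly (series_poly.eval (pderiv \<chi>) W) (fps_const c) \<noteq> 0"
    using poly_fps_const_nonzero[OF assms(1) \<chi>(2)] by blast
  define w where "w = poly W (fps_const c)"
  define S where "S = map_poly (\<lambda>q. poly q [:c:])"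
  have eval_S: "series.eval (S \<xi>) w = poly (series_poly.eval \<xi> W) (fps_const c)" for \<xi>
    by (simp add: S_def w_def poly_eval_specialize)
  have f: "series.eval (S \<chi>) w = 0" "series.eval (pderiv (S \<chi>)) w \<noteq> 0"
    using \<chi>(1) c eval_S[of \<chi>] eval_S[of "pderiv \<chi>"]
    by (simp_all add: S_def poly_hom.map_poly_pderiv)
  have "series.eval (S (map_poly pderiv \<chi>)) w + series.eval (S (pderiv \<chi>)) w * r = 0"
    using arg_cong[OF deriv, of "\<lambda>P. poly P (fps_const c)"] by (simp add: eval_S mult.commute)
  moreover have "series.eval (S (pderiv \<chi>)) w \<noteq> 0"
    using c by (simp add: eval_S)
  ultimately have r: "r \<in> series.rational_over w"
    by (rule series.rational_over_linear[rotated])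
  have "z = series.eval [:0, 1:] w - series.eval [:[:c:]:] w * r"
    by (simp add: w_def W_def fps_of_poly_const hom_distribs)
  then have "z \<in> series.rational_over w"
    using r is_subring_diff is_subring_mult series.is_subring_rational_over
    by (metis series.rational_over_eval_self)
  with f r that show ?thesis by blast
qed

lemma primitive_element_finite:
  fixes S :: "'a::field fps set"
  assumes "infinite (UNIV :: 'a set)" "finite S" "\<And>x. x \<in> S \<Longrightarrow> series.algebraic_over x"
  obtains w f where "series.eval f w = 0" "series.eval (pderiv f) w \<noteq> 0" "S \<subseteq> series.rational_over w"
proof -
  have "\<exists>w f. series.eval f w = 0 \<and> series.eval (pderiv f) w \<noteq> 0 \<and> S \<subseteq> series.rational_over w"
    using assms(2,3)
  proof (induction S rule: finite_induct)
    case empty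
    show ?case by (intro exI[of _ 0] exI[of _ "[:0, 1:]"]) (simp add: pderiv_pCons)
  next
    case (insert x S)
    then obtain w f where w: "series.eval f w = 0" "series.eval (pderiv f) w \<noteq> 0" "S \<subseteq> series.rational_over w"
      by auto
    then have "series.algebraic_over w"
      unfolding series.algebraic_over_def by (intro exI[of _ f]) auto
    then obtain w' f' where "series.eval f' w' = 0" "series.eval (pderiv f') w' \<noteq> 0"
      "w \<in> series.rational_over w'" "x \<in> series.rational_over w'"
      by (rule primitive_element[OF assms(1), of w x]) (use insert.prems in auto)
    then show ?case using w(3) series.rational_over_trans by blast
  qed
  then show ?thesis using that by blast
qed

section \<open>Smooth parametrisations\<close>

lemma poly_taylor:
  fixes x d :: "'a::idom"
  obtains u where "poly P (x + d) = poly P x + poly (pderiv P) x * d + d\<^sup>2 * u"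
proof -
  have "\<exists>u. poly P (x + d) = poly P x + poly (pderiv P) x * d + d\<^sup>2 * u"
  proof (induction P)
    case 0
    show ?case by (intro exI[of _ 0]) simp
  next
    case (pCons a P)
    then obtain u where u: "poly P (x + d) = poly P x + poly (pderiv P) x * d + d\<^sup>2 * u" by blast
    show ?case
      by (intro exI[of _ "x * u + poly (pderiv P) x + d * u"])
         (simp only: poly_pCons u pderiv_pCons poly_add, simp add: algebra_simps power2_eq_square)
  qed
  then show ?thesis using that by blast
qed

lemma pcompose_taylor:
  fixes P q d :: "'a::idom poly"
  obtains u where "pcompose P (q + d) = pcompose P q + pcompose (pderiv P) q * d + d\<^sup>2 * u"
proof -
  interpret const: idom_hom "\<lambda>a :: 'a. [:a:]" by unfold_locales auto
  show ?thesis
    using poly_taylor[of "map_poly (\<lambda>a. [:a:]) P" q d] that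
    unfolding pcompose_altdef const.map_poly_pderiv by blast
qed

lemma diff_dvd_poly_diff:
  fixes x y :: "'a::idom"
  shows "x - y dvd poly P x - poly P y"
proof -
  obtain u where u: "poly P (y + (x - y)) = poly P y + poly (pderiv P) y * (x - y) + (x - y)\<^sup>2 * u"
    by (rule poly_taylor)
  then have "poly P x - poly P y = (x - y) * (poly (pderiv P) y + (x - y) * u)"
    by (simp add: algebra_simps power2_eq_square)
  then show ?thesis by simp
qed

lemma fps_X_power_dvd_iff: "fps_X ^ n dvd (x :: 'a::field fps) \<longleftrightarrow> (\<forall>k<n. x $ k = 0)"
proof
  assume "\<forall>k<n. x $ k = 0"
  then have "x = fps_X ^ n * fps_shift n x" by (intro fps_ext) (simp add: fps_X_power_mult_nth)
  then show "fps_X ^ n dvd x" by (metis dvd_triv_left)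
qed (auto simp: dvd_def fps_X_power_mult_nth)

lemma fps_X_power_dvd_fps_of_poly_iff:
  "fps_X ^ n dvd fps_of_poly p \<longleftrightarrow> monom 1 n dvd (p :: 'a::field poly)"
  by (simp add: fps_X_power_dvd_iff monom_1_dvd_iff')

interpretation eval_XY_hom: idom_hom "\<lambda>f. eval_XY f a b" for a b :: "'a::idom"
  by unfold_locales (simp_all add: eval_XY_def)

lemma eval_XY_pCons: "eval_XY (pCons c f) a b = poly c a + b * eval_XY f a b"
  by (simp add: eval_XY_def)

lemma eval_XY_smult: "eval_XY (smult c f) a b = poly c a * eval_XY f a b"
  by (simp add: eval_XY_def)

lemma eval_XY_map_poly: "eval_XY f a b = poly (map_poly (\<lambda>q. poly q a) f) (b :: 'a::idom)"
  by (induction f) (simp_all add: eval_XY_pCons map_poly_pCons)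

lemma series_eval_nth_0: "series.eval f z $ 0 = eval_XY f 0 (z $ 0)"
  by (induction f) (simp_all add: hom_distribs eval_XY_pCons poly_0_coeff_0)

lemma truncation_preserves_order:
  fixes z :: "'a::field fps"
  assumes w: "w = fps_of_poly s + fps_X ^ Suc e * z"
    and e: "series.eval p w \<noteq> 0" "e = subdegree (series.eval p w)"
  obtains b where "poly p s = monom 1 e * b" "coeff b 0 \<noteq> 0"
proof -
  define D where "D = series.eval p w"
  have "fps_X ^ Suc e dvd D - fps_of_poly (poly p s)"
    using diff_dvd_poly_diff[of w "fps_of_poly s" "map_poly fps_of_poly p"]
    by (auto simp: w D_def intro: dvd_trans[OF dvd_triv_left])
  then have "\<forall>k<Suc e. (D - fps_of_poly (poly p s)) $ k = 0"
    by (simp only: fps_X_power_dvd_iff)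
  then have coeff_s: "coeff (poly p s) k = D $ k" if "k \<le> e" for k
    using that by (simp add: less_Suc_eq_le)
  then have "monom 1 e dvd poly p s"
    unfolding monom_1_dvd_iff' using nth_less_subdegree_zero[of _ D] by (simp add: D_def flip: e(2))
  then obtain b where b: "poly p s = monom 1 e * b" by (auto simp: dvd_def)
  have "coeff b 0 = D $ e"
    using coeff_s[of e] by (simp add: b coeff_monom_mult)
  then show ?thesis
    using that b e by (simp add: D_def)
qed

text \<open>
  By Taylor's formula \<open>f(t, s + t\<^sup>N Z)\<close> with \<open>N = e + 1\<close> is divisible by \<open>t\<close> to the power \<open>N + e\<close>,
  and the coefficient of \<open>Z\<close> in the quotient is \<open>b\<close>.
\<close>

lemma taylor_quotient_relation:
  fixes z :: "'a::field fps"
  assumes b: "poly (pderiv f) s = monom 1 e * b"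
    and f: "series.eval f (fps_of_poly s + fps_X ^ Suc e * z) = 0"
  obtains g where "series.eval g z = 0" "eval_XY (pderiv g) 0 0 = coeff b 0"
proof -
  define N where "N = Suc e"
  obtain u where u: "pcompose f ([:s:] + [:0, monom 1 N:]) =
      pcompose f [:s:] + pcompose (pderiv f) [:s:] * [:0, monom 1 N:] + [:0, monom 1 N:]\<^sup>2 * u"
    by (rule pcompose_taylor)
  define F where "F = pcompose f [:s, monom 1 N:]"
  have "series.eval [:s, monom 1 N:] z = fps_of_poly s + fps_X ^ Suc e * z"
    by (simp add: hom_distribs fps_of_poly_monom' mult.commute N_def)
  then have F0: "series.eval F z = 0"
    by (simp only: F_def series.map_poly_pcompose poly_pcompose f)
  have F: "F = [:poly f s, monom 1 (N + e) * b:] + smult (monom 1 (N + e)) ([:0, 0, monom 1 1:] * u)"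
    using u by (simp add: F_def pcompose_pCons_0 b mult_monom power2_eq_square N_def)
  have "fps_of_poly (poly f s) =
      fps_X ^ (N + e) * - (z * fps_of_poly b + series.eval ([:0, 0, monom 1 1:] * u) z)"
    using F0 unfolding F
    by (simp add: hom_distribs fps_of_poly_mult fps_of_poly_monom' algebra_simps eq_neg_iff_add_eq_0)
  then have "fps_X ^ (N + e) dvd fps_of_poly (poly f s)" by (metis dvd_triv_left)
  then obtain a where a: "poly f s = monom 1 (N + e) * a"
    unfolding fps_X_power_dvd_fps_of_poly_iff by (auto simp: dvd_def)
  define g where "g = [:a, b:] + [:0, 0, monom 1 1:] * u"
  have "F = smult (monom 1 (N + e)) g"
    by (simp add: F g_def a smult_add_right)
  then have "series.eval g z = 0"
    using F0 by (simp add: hom_distribs fps_of_poly_monom')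
  moreover have "eval_XY (pderiv g) 0 0 = coeff b 0"
    by (simp add: g_def pderiv_add pderiv_mult pderiv_pCons eval_XY_def poly_0_coeff_0 poly_monom)
  ultimately show ?thesis by (rule that)
qed

lemma smooth_parametrization_exists:
  fixes w :: "'a::field fps"
  assumes f: "series.eval f w = 0" "series.eval (pderiv f) w \<noteq> 0"
  obtains z g where "z $ 0 = 0" "series.eval g z = 0" "eval_XY (pderiv g) 0 0 \<noteq> 0"
    "w \<in> series.rational_over z"
proof -
  define e where "e = subdegree (series.eval (pderiv f) w)"
  define s where "s = truncate_fps (Suc (Suc e)) w"
  define z where "z = fps_X * fps_shift (Suc (Suc e)) w"
  have w: "w = fps_of_poly s + fps_X ^ Suc e * z"
    using fps_shift_cutoff'[of "Suc (Suc e)" w] by (simp add: s_def z_def mult_ac add.commute)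
  obtain b where b: "poly (pderiv f) s = monom 1 e * b" "coeff b 0 \<noteq> 0"
    by (rule truncation_preserves_order[OF w f(2) e_def])
  obtain g where "series.eval g z = 0" "eval_XY (pderiv g) 0 0 = coeff b 0"
    using taylor_quotient_relation[OF b(1)] f(1) w by metis
  moreover have "w = series.eval [:s, monom 1 (Suc e):] z"
    by (subst w) (simp add: hom_distribs fps_of_poly_monom' mult.commute)
  then have "w \<in> series.rational_over z"
    by (metis series.rational_over_eval_self)
  moreover have "z $ 0 = 0" by (simp add: z_def)
  ultimately show ?thesis using that b(2) by metis
qed

section \<open>Specialising algebraic power series over a large field\<close>

lemma smult_linear_if_zero_fibre:
  fixes a :: "'a::idom"
  assumes "map_poly (\<lambda>q. poly q a) S = 0"
  obtains S' where "S = smult [:- a, 1:] S'"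
proof -
  have "poly (coeff S k) a = 0" for k
    using arg_cong[OF assms, of "\<lambda>p. coeff p k"] by (simp add: coeff_map_poly)
  then have "[:[:- a, 1:]:] dvd S" by (simp add: const_poly_dvd_iff poly_eq_0_iff_dvd)
  then show ?thesis using that by (auto simp: dvd_def)
qed

lemma minimal_relation_exists:
  fixes z :: "'a::field fps"
  assumes "series.algebraic_over z"
  obtains G where "G \<noteq> 0" "series.eval G z = 0" "\<And>a. map_poly (\<lambda>q. poly q a) G \<noteq> 0"
    "\<And>R. series.eval R z = 0 \<Longrightarrow> \<exists>k S. smult (lead_coeff G ^ k) R = G * S"
proof -
  define I where "I = {R. R \<noteq> 0 \<and> series.eval R z = 0}"
  have wf: "wf (measures [degree, \<lambda>R :: 'a poly poly. degree (lead_coeff R)])" by simp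
  obtain G where G: "G \<in> I"
    and min: "\<And>R. (R, G) \<in> measures [degree, \<lambda>R. degree (lead_coeff R)] \<Longrightarrow> R \<notin> I"
    using assms wfE_min[OF wf, of _ I] unfolding I_def series.algebraic_over_def by blast
  have G0: "G \<noteq> 0" "series.eval G z = 0" using G by (auto simp: I_def)
  have "map_poly (\<lambda>q. poly q a) G \<noteq> 0" for a
  proof
    assume "map_poly (\<lambda>q. poly q a) G = 0"
    then obtain G' where G': "G = smult [:- a, 1:] G'" by (rule smult_linear_if_zero_fibre)
    have "fps_of_poly [:- a, 1:] \<noteq> 0" by simp
    with G0 G' have "G' \<in> I" by (auto simp: I_def hom_distribs)
    moreover have "lead_coeff G' \<noteq> 0" using G0 G' by auto
    then have "degree (lead_coeff G) = Suc (degree (lead_coeff G'))"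
      unfolding G' lead_coeff_smult by (subst degree_mult_eq) auto
    then have "(G', G) \<in> measures [degree, \<lambda>R. degree (lead_coeff R)]"
      using G' by (simp add: degree_smult_eq)
    ultimately show False using min by blast
  qed
  moreover have "\<exists>k S. smult (lead_coeff G ^ k) R = G * S" if R: "series.eval R z = 0" for R
  proof -
    obtain S r where "pseudo_divmod R G = (S, r)" by fastforce
    from pseudo_divmod[OF G0(1) this]
    have S: "smult (lead_coeff G ^ (Suc (degree R) - degree G)) R = G * S + r"
      and r: "r = 0 \<or> degree r < degree G" by auto
    have "series.eval r z = 0"
      using arg_cong[OF S, of "\<lambda>p. series.eval p z"] R G0(2) by (simp add: hom_distribs)
    then have "r = 0" using r min[of r] by (auto simp: I_def)
    with S show ?thesis by auto
  qed
  ultimately show ?thesis using that G0 by blast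
qed

lemma cancel_vertical_factor:
  fixes g G S :: "'a::idom poly poly"
  assumes "map_poly (\<lambda>q. poly q a) G \<noteq> 0" "smult ([:- a, 1:] ^ k * m) g = G * S"
  obtains S' where "smult m g = G * S'"
proof -
  have "\<exists>S'. smult m g = G * S'"
    using assms(2)
  proof (induction k arbitrary: S)
    case 0
    then show ?case by auto
  next
    case (Suc k)
    interpret fibre: map_poly_idom_hom "\<lambda>q. poly q a" ..
    have "map_poly (\<lambda>q. poly q a) (G * S) = 0"
      unfolding Suc.prems[symmetric] by (simp add: hom_distribs)
    then have "map_poly (\<lambda>q. poly q a) S = 0"
      using assms(1) by (simp add: fibre.hom_mult)
    then obtain S' where "S = smult [:- a, 1:] S'" by (rule smult_linear_if_zero_fibre)
    then have "smult [:- a, 1:] (smult ([:- a, 1:] ^ k * m) g) = smult [:- a, 1:] (G * S')"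
      using Suc.prems by (simp only: smult_smult mult_smult_right power_Suc mult.assoc)
    then have "smult ([:- a, 1:] ^ k * m) g = G * S'"
      by (metis smult_cancel pCons_eq_0_iff one_neq_zero)
    then show ?case by (rule Suc.IH)
  qed
  then show ?thesis using that by blast
qed

lemma smooth_at_point_factor:
  fixes g G :: "'a::field poly poly"
  assumes G: "map_poly (\<lambda>q. poly q a) G \<noteq> 0" "eval_XY G a b = 0"
    and g: "eval_XY (pderiv g) a b \<noteq> 0" "smult m g = G * S" "m \<noteq> 0"
  shows "eval_XY (pderiv G) a b \<noteq> 0"
proof -
  obtain m' where m': "m = [:- a, 1:] ^ order a m * m'" "\<not> [:- a, 1:] dvd m'"
    using order_decomp[OF g(3), of a] by auto
  obtain S' where S': "smult m' g = G * S'"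
    using cancel_vertical_factor[OF G(1), of "order a m" m' g S] g(2) m'(1) by metis
  have "smult m' (pderiv g) = G * pderiv S' + S' * pderiv G"
    using arg_cong[OF S', of pderiv] by (simp add: pderiv_smult pderiv_mult)
  from arg_cong[OF this, of "\<lambda>f. eval_XY f a b"]
  have "poly m' a * eval_XY (pderiv g) a b = eval_XY S' a b * eval_XY (pderiv G) a b"
    by (simp add: eval_XY_smult hom_distribs G(2))
  moreover have "poly m' a \<noteq> 0"
    using m'(2) by (simp add: poly_eq_0_iff_dvd)
  ultimately show ?thesis using g(1) by auto
qed

text \<open>The Zariski closure of the plane curve parametrised by \<open>(t, z)\<close>.\<close>

definition curve_points :: "'a::field fps \<Rightarrow> ('a \<times> 'a) set" where
  "curve_points z = {(a, b). \<forall>R. series.eval R z = 0 \<longrightarrow> eval_XY R a b = 0}"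

lemma infinite_fst_curve_points:
  fixes z :: "'a::field fps"
  assumes large: "large_field TYPE('a)"
    and z: "z $ 0 = 0" "series.eval g z = 0" "eval_XY (pderiv g) 0 0 \<noteq> 0"
  shows "infinite (fst ` curve_points z)"
proof
  assume finite_fst: "finite (fst ` curve_points z)"
  have "g \<noteq> 0" using z(3) by auto
  then have "series.algebraic_over z" using z(2) by (auto simp: series.algebraic_over_def)
  then obtain G where G: "G \<noteq> 0" "series.eval G z = 0" "\<And>a. map_poly (\<lambda>q. poly q a) G \<noteq> 0"
    "\<And>R. series.eval R z = 0 \<Longrightarrow> \<exists>k S. smult (lead_coeff G ^ k) R = G * S"
    by (rule minimal_relation_exists) blast
  have origin: "eval_XY G 0 0 = 0"
    using series_eval_nth_0[of G z] G(2) z(1) by simp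
  obtain k S where "smult (lead_coeff G ^ k) g = G * S" using G(4)[OF z(2)] by blast
  then have "eval_XY (pderiv G) 0 0 \<noteq> 0"
    using G(1) by (intro smooth_at_point_factor[OF G(3) origin z(3)]) auto
  then have "infinite {(a, b). eval_XY G a b = 0}"
    using large origin unfolding large_field_def by blast
  moreover have "{(a, b). eval_XY G a b = 0} \<subseteq>
      (SIGMA a : {a. poly (lead_coeff G) a = 0} \<union> fst ` curve_points z.
        {b. poly (map_poly (\<lambda>q. poly q a) G) b = 0})"
  proof (clarsimp simp flip: eval_XY_map_poly)
    fix a b assume ab: "eval_XY G a b = 0" "a \<notin> fst ` curve_points z"
    have "(a, b) \<in> curve_points z" if "poly (lead_coeff G) a \<noteq> 0"
      unfolding curve_points_def
    proof (intro CollectI case_prodI allI impI)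
      fix R assume "series.eval R z = 0"
      then obtain k S where "smult (lead_coeff G ^ k) R = G * S" using G(4) by blast
      from arg_cong[OF this, of "\<lambda>f. eval_XY f a b"] show "eval_XY R a b = 0"
        using ab(1) that by (simp add: eval_XY_smult hom_distribs)
    qed
    then show "poly (lead_coeff G) a = 0" using ab(2) by force
  qed
  moreover have "finite (SIGMA a : {a. poly (lead_coeff G) a = 0} \<union> fst ` curve_points z.
      {b. poly (map_poly (\<lambda>q. poly q a) G) b = 0})"
    using finite_fst G(1,3) by (intro finite_SigmaI finite_UnI poly_roots_finite) auto
  ultimately show False using finite_subset by blast
qed

lemma curve_points_nonzero:
  fixes z :: "'a::field fps"
  assumes "series.algebraic_over z" "series.eval N z \<noteq> 0"
  shows "finite (fst ` {(a, b) \<in> curve_points z. eval_XY N a b = 0})"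
proof -
  have "series.algebraic_over (series.eval N z)"
    using assms(1) by (intro series.algebraic_over_poly) (simp_all add: series.algebraic_over_hom)
  then obtain p where p: "coeff p 0 \<noteq> 0" "series.eval p (series.eval N z) = 0"
    using series.algebraic_over_nonzero_relation assms(2) by blast
  obtain p\<^sub>0 p\<^sub>1 where p01: "p = pCons p\<^sub>0 p\<^sub>1" by (cases p)
  have relation: "series.eval ([:p\<^sub>0:] + N * pcompose p\<^sub>1 N) z = 0"
    using p(2) by (simp add: p01 hom_distribs poly_pcompose)
  have "poly p\<^sub>0 a = 0" if ab: "(a, b) \<in> curve_points z" "eval_XY N a b = 0" for a b
  proof -
    have "eval_XY ([:p\<^sub>0:] + N * pcompose p\<^sub>1 N) a b = 0"
      using ab(1) relation unfolding curve_points_def by blast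
    then show ?thesis using ab(2) by (simp add: hom_distribs eval_XY_pCons)
  qed
  then have "fst ` {(a, b) \<in> curve_points z. eval_XY N a b = 0} \<subseteq> {a. poly p\<^sub>0 a = 0}" by auto
  moreover have "finite {a. poly p\<^sub>0 a = 0}" using p(1) p01 by (intro poly_roots_finite) auto
  ultimately show ?thesis by (rule finite_subset)
qed

lemma curve_point_avoiding:
  fixes z :: "'a::field fps"
  assumes large: "large_field TYPE('a)"
    and z: "z $ 0 = 0" "series.eval g z = 0" "eval_XY (pderiv g) 0 0 \<noteq> 0"
    and N: "finite \<N>" "\<And>N. N \<in> \<N> \<Longrightarrow> series.eval N z \<noteq> 0"
  obtains a b where "(a, b) \<in> curve_points z" "\<And>N. N \<in> \<N> \<Longrightarrow> eval_XY N a b \<noteq> 0"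
proof -
  define bad where "bad = (\<Union>N\<in>\<N>. fst ` {(a, b) \<in> curve_points z. eval_XY N a b = 0})"
  have "g \<noteq> 0" using z(3) by auto
  then have "series.algebraic_over z" using z(2) by (auto simp: series.algebraic_over_def)
  then have "finite bad"
    unfolding bad_def using N by (intro finite_UN_I curve_points_nonzero)
  then obtain a where "a \<in> fst ` curve_points z" "a \<notin> bad"
    using infinite_fst_curve_points[OF large z] by (meson finite_subset subsetI)
  then show ?thesis
    using that by (force simp: bad_def)
qed

locale specialization =
  fixes B :: "'a::field fps set" and \<phi> :: "'a fps \<Rightarrow> 'a"
  assumes subring: "is_subring B"
    and const_in: "fps_const a \<in> B"
    and const: "\<phi> (fps_const a) = a"
    and diff: "x \<in> B \<Longrightarrow> y \<in> B \<Longrightarrow> \<phi> (x - y) = \<phi> x - \<phi> y"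
    and mult: "x \<in> B \<Longrightarrow> y \<in> B \<Longrightarrow> \<phi> (x * y) = \<phi> x * \<phi> y"

definition takes_value :: "'a::field fps \<Rightarrow> 'a \<times> 'a \<Rightarrow> 'a fps \<Rightarrow> 'a \<Rightarrow> bool" where
  "takes_value z P \<alpha> v \<longleftrightarrow> (\<exists>h q. series.is_quotient z \<alpha> h q \<and>
     eval_XY q (fst P) (snd P) \<noteq> 0 \<and> v = eval_XY h (fst P) (snd P) / eval_XY q (fst P) (snd P))"

lemma takes_value_unique:
  assumes "P \<in> curve_points z" "takes_value z P \<alpha> v" "takes_value z P \<alpha> v'"
  shows "v = v'"
proof -
  obtain a b where P: "P = (a, b)" by (cases P)
  obtain h q where q: "series.eval q z * \<alpha> = series.eval h z" "eval_XY q a b \<noteq> 0"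
    "v = eval_XY h a b / eval_XY q a b"
    using assms(2) unfolding P takes_value_def series.is_quotient_def by auto
  obtain h' q' where q': "series.eval q' z * \<alpha> = series.eval h' z" "eval_XY q' a b \<noteq> 0"
    "v' = eval_XY h' a b / eval_XY q' a b"
    using assms(3) unfolding P takes_value_def series.is_quotient_def by auto
  have "series.eval (h * q' - h' * q) z = 0"
    by (simp add: hom_distribs flip: q(1) q'(1))
  then have "eval_XY (h * q' - h' * q) a b = 0"
    using assms(1) unfolding P curve_points_def by blast
  then show ?thesis
    using q(2,3) q'(2,3) by (simp add: hom_distribs frac_eq_eq)
qed

lemma takes_value_const: "takes_value z P (fps_const c) c"
  unfolding takes_value_def series.is_quotient_def
  by (intro exI[of _ "[:[:c:]:]"] exI[of _ 1]) (simp add: hom_distribs fps_of_poly_const eval_XY_pCons)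

lemma takes_value_diff:
  assumes "takes_value z P \<alpha> v" "takes_value z P \<beta> v'"
  shows "takes_value z P (\<alpha> - \<beta>) (v - v')"
proof -
  let ?e = "\<lambda>f. eval_XY f (fst P) (snd P)"
  obtain h q where q: "series.is_quotient z \<alpha> h q" "?e q \<noteq> 0" "v = ?e h / ?e q"
    using assms(1) unfolding takes_value_def by blast
  obtain h' q' where q': "series.is_quotient z \<beta> h' q'" "?e q' \<noteq> 0" "v' = ?e h' / ?e q'"
    using assms(2) unfolding takes_value_def by blast
  have "v - v' = ?e (q' * h - q * h') / ?e (q * q')" "?e (q * q') \<noteq> 0"
    using q(2,3) q'(2,3) by (simp_all add: hom_distribs diff_frac_eq mult.commute)
  then show ?thesis
    using series.is_quotient_diff[OF q(1) q'(1)] unfolding takes_value_def by blast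
qed

lemma takes_value_mult:
  assumes "takes_value z P \<alpha> v" "takes_value z P \<beta> v'"
  shows "takes_value z P (\<alpha> * \<beta>) (v * v')"
proof -
  let ?e = "\<lambda>f. eval_XY f (fst P) (snd P)"
  obtain h q where q: "series.is_quotient z \<alpha> h q" "?e q \<noteq> 0" "v = ?e h / ?e q"
    using assms(1) unfolding takes_value_def by blast
  obtain h' q' where q': "series.is_quotient z \<beta> h' q'" "?e q' \<noteq> 0" "v' = ?e h' / ?e q'"
    using assms(2) unfolding takes_value_def by blast
  have "v * v' = ?e (h * h') / ?e (q * q')" "?e (q * q') \<noteq> 0"
    using q(2,3) q'(2,3) by (simp_all add: hom_distribs)
  then show ?thesis
    using series.is_quotient_mult[OF q(1) q'(1)] unfolding takes_value_def by blast
qed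

lemma specialization_at_curve_point:
  assumes "P \<in> curve_points z"
  obtains B \<phi> where "specialization B \<phi>" "\<And>\<alpha> v. takes_value z P \<alpha> v \<Longrightarrow> \<alpha> \<in> B \<and> \<phi> \<alpha> = v"
proof -
  define B where "B = {\<alpha>. \<exists>v. takes_value z P \<alpha> v}"
  define \<phi> where "\<phi> \<alpha> = (THE v. takes_value z P \<alpha> v)" for \<alpha>
  have value_at: "\<alpha> \<in> B \<and> \<phi> \<alpha> = v" if "takes_value z P \<alpha> v" for \<alpha> v
    using that takes_value_unique[OF assms] unfolding B_def \<phi>_def by blast
  have takes_\<phi>: "takes_value z P \<alpha> (\<phi> \<alpha>)" if "\<alpha> \<in> B" for \<alpha>
    using that value_at unfolding B_def by blast
  have "specialization B \<phi>"
  proof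
    show "fps_const a \<in> B" "\<phi> (fps_const a) = a" for a
      using value_at[OF takes_value_const] by blast+
    have diff: "x - y \<in> B \<and> \<phi> (x - y) = \<phi> x - \<phi> y" if "x \<in> B" "y \<in> B" for x y
      by (intro value_at takes_value_diff takes_\<phi> that)
    have mult: "x * y \<in> B \<and> \<phi> (x * y) = \<phi> x * \<phi> y" if "x \<in> B" "y \<in> B" for x y
      by (intro value_at takes_value_mult takes_\<phi> that)
    show "\<phi> (x - y) = \<phi> x - \<phi> y" "\<phi> (x * y) = \<phi> x * \<phi> y" if "x \<in> B" "y \<in> B" for x y
      using diff[OF that] mult[OF that] by blast+
    have "1 \<in> B" using value_at[OF takes_value_const[of z P 1]] by simp
    with diff mult show "is_subring B" unfolding is_subring_def by blast
  qed
  with value_at that show ?thesis by blast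
qed

lemma infinite_UNIV_if_large_field:
  assumes "large_field TYPE('a::field)"
  shows "infinite (UNIV :: 'a set)"
proof
  assume "finite (UNIV :: 'a set)"
  then have "finite (UNIV :: ('a \<times> 'a) set)" by (simp add: finite_Prod_UNIV)
  then have "finite {(a, b). eval_XY [:0, 1 :: 'a poly:] a b = 0}" by (rule finite_subset[rotated]) auto
  moreover have "eval_XY [:0, 1 :: 'a poly:] 0 0 = 0" "eval_XY (pderiv [:0, 1 :: 'a poly:]) 0 0 \<noteq> 0"
    by (simp_all add: eval_XY_def pderiv_pCons)
  ultimately show False using assms unfolding large_field_def by blast
qed

theorem large_field_specialization:
  fixes S :: "'a::field fps set"
  assumes large: "large_field TYPE('a)" and "finite S" "\<And>x. x \<in> S \<Longrightarrow> series.algebraic_over x"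
  obtains B \<phi> where "specialization B \<phi>" "S \<subseteq> B" "\<And>x. x \<in> S \<Longrightarrow> x \<noteq> 0 \<Longrightarrow> \<phi> x \<noteq> 0"
proof -
  obtain w f where w: "series.eval f w = 0" "series.eval (pderiv f) w \<noteq> 0" "S \<subseteq> series.rational_over w"
    using primitive_element_finite[OF infinite_UNIV_if_large_field[OF large] assms(2,3)] by blast
  obtain z g where z: "z $ 0 = 0" "series.eval g z = 0" "eval_XY (pderiv g) 0 0 \<noteq> 0"
    "w \<in> series.rational_over z"
    using smooth_parametrization_exists[OF w(1,2)] by blast
  have "\<forall>x\<in>S. \<exists>h q. series.eval q z \<noteq> 0 \<and> series.is_quotient z x h q"
    using w(3) z(4) series.rational_over_trans unfolding series.rational_over_def by blast
  then obtain h q where hq: "\<And>x. x \<in> S \<Longrightarrow> series.eval (q x) z \<noteq> 0"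
    "\<And>x. x \<in> S \<Longrightarrow> series.is_quotient z x (h x) (q x)"
    by metis
  have h_nonzero: "series.eval (h x) z \<noteq> 0" if "x \<in> S" "x \<noteq> 0" for x
    using hq[OF that(1)] that(2) unfolding series.is_quotient_def by (metis mult_eq_0_iff)
  obtain a b where ab: "(a, b) \<in> curve_points z"
    "\<And>N. N \<in> q ` S \<union> h ` (S - {0}) \<Longrightarrow> eval_XY N a b \<noteq> 0"
    by (rule curve_point_avoiding[OF large z(1-3), of "q ` S \<union> h ` (S - {0})"])
       (use assms(2) hq(1) h_nonzero in auto)
  obtain B \<phi> where B: "specialization B \<phi>"
    "\<And>\<alpha> v. takes_value z (a, b) \<alpha> v \<Longrightarrow> \<alpha> \<in> B \<and> \<phi> \<alpha> = v"
    using specialization_at_curve_point[OF ab(1)] by blast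
  have "x \<in> B \<and> \<phi> x = eval_XY (h x) a b / eval_XY (q x) a b" if "x \<in> S" for x
    using B(2)[of x] hq(2)[OF that] ab(2)[of "q x"] that unfolding takes_value_def by auto
  then show ?thesis
    using that[OF B(1)] ab(2) by auto
qed

section \<open>Hensel's lemma for power series\<close>

definition simple_root :: "'a::idom poly \<Rightarrow> 'a \<Rightarrow> bool" where
  "simple_root p x \<longleftrightarrow> poly p x = 0 \<and> poly (pderiv p) x \<noteq> 0"

lemma simple_root_linear [simp]: "simple_root [:a, b:] y \<longleftrightarrow> a + y * b = 0 \<and> b \<noteq> 0"
  by (simp add: simple_root_def pderiv_pCons)

interpretation fps_nth_0_hom: idom_hom "\<lambda>x :: 'a::field fps. x $ 0"
  by unfold_locales auto

lemma hensel_refinement: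
  fixes P :: "'a::field fps poly"
  assumes x: "fps_X ^ Suc n dvd poly P x" and simple: "poly (pderiv P) x $ 0 \<noteq> 0"
  obtains y where "fps_X ^ Suc n dvd y - x" "fps_X ^ Suc (Suc n) dvd poly P y"
proof -
  define a where "a = inverse (poly (pderiv P) x $ 0)"
  define \<delta> where "\<delta> = - (fps_const a * poly P x)"
  have \<delta>: "fps_X ^ Suc n dvd \<delta>"
    unfolding \<delta>_def by (subst dvd_minus_iff) (rule dvd_mult[OF x])
  obtain u where u: "poly P (x + \<delta>) = poly P x + poly (pderiv P) x * \<delta> + \<delta>\<^sup>2 * u"
    by (rule poly_taylor)
  have "fps_X ^ 1 dvd 1 - poly (pderiv P) x * fps_const a"
    using simple unfolding fps_X_power_dvd_iff by (simp add: a_def)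
  from mult_dvd_mono[OF x this]
  have "fps_X ^ Suc (Suc n) dvd poly P x + poly (pderiv P) x * \<delta>"
    by (simp add: \<delta>_def algebra_simps)
  moreover have "fps_X ^ Suc (Suc n) dvd \<delta>\<^sup>2 * u"
  proof -
    have "fps_X ^ Suc (Suc n) dvd fps_X ^ (Suc n + Suc n)" by (rule le_imp_power_dvd) simp
    also have "\<dots> dvd \<delta>\<^sup>2" using mult_dvd_mono[OF \<delta> \<delta>] by (simp only: power_add power2_eq_square)
    finally show ?thesis by (rule dvd_mult2)
  qed
  ultimately have "fps_X ^ Suc (Suc n) dvd poly P (x + \<delta>)"
    unfolding u by (rule dvd_add)
  then show ?thesis using that[of "x + \<delta>"] \<delta> by simp
qed

lemma fps_limit_exists:
  fixes x :: "nat \<Rightarrow> 'a::field fps"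
  assumes "\<And>n. fps_X ^ Suc n dvd x (Suc n) - x n"
  obtains \<rho> where "\<And>n. fps_X ^ Suc n dvd \<rho> - x n"
proof -
  have stable: "x n $ k = x k $ k" if "k \<le> n" for n k
    using that
  proof (induction n rule: dec_induct)
    case (step n)
    have "\<forall>i<Suc n. (x (Suc n) - x n) $ i = 0"
      using assms[of n] by (simp only: fps_X_power_dvd_iff)
    then show ?case using step by simp
  qed simp
  define \<rho> where "\<rho> = Abs_fps (\<lambda>n. x n $ n)"
  have "fps_X ^ Suc n dvd \<rho> - x n" for n
    unfolding fps_X_power_dvd_iff
  proof (intro allI impI)
    fix k assume "k < Suc n"
    then have "x n $ k = x k $ k" by (intro stable) simp
    then show "(\<rho> - x n) $ k = 0" by (simp only: \<rho>_def fps_sub_nth fps_nth_Abs_fps diff_self)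
  qed
  then show ?thesis by (rule that)
qed

lemma hensel_sequence_exists:
  fixes P :: "'a::field fps poly"
  assumes root: "\<And>x. x $ 0 = r \<Longrightarrow> poly P x $ 0 = 0"
    and simple: "\<And>x. x $ 0 = r \<Longrightarrow> poly (pderiv P) x $ 0 \<noteq> 0"
  obtains x where "\<And>n. x n $ 0 = r" "\<And>n. fps_X ^ Suc n dvd poly P (x n)"
    "\<And>n. fps_X ^ Suc n dvd x (Suc n) - x n"
proof -
  have "\<exists>x. \<forall>n. (x n $ 0 = r \<and> fps_X ^ Suc n dvd poly P (x n)) \<and> fps_X ^ Suc n dvd x (Suc n) - x n"
  proof (intro dependent_nat_choice)
    show "\<exists>x. x $ 0 = r \<and> fps_X ^ Suc 0 dvd poly P x"
      using root[of "fps_const r"] by (intro exI[of _ "fps_const r"]) (simp only: fps_X_power_dvd_iff, simp)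
  next
    fix x n assume x: "x $ 0 = r \<and> fps_X ^ Suc n dvd poly P x"
    obtain y where y: "fps_X ^ Suc n dvd y - x" "fps_X ^ Suc (Suc n) dvd poly P y"
      using hensel_refinement x simple by blast
    have "\<forall>k<Suc n. (y - x) $ k = 0"
      using y(1) by (simp only: fps_X_power_dvd_iff)
    then have "y $ 0 = r" using x by simp
    then show "\<exists>y. (y $ 0 = r \<and> fps_X ^ Suc (Suc n) dvd poly P y) \<and> fps_X ^ Suc n dvd y - x"
      using y by blast
  qed
  then show ?thesis using that by blast
qed

theorem fps_hensel:
  fixes P :: "'a::field fps poly"
  assumes "simple_root (map_poly (\<lambda>c. c $ 0) P) r"
  obtains \<rho> where "\<rho> $ 0 = r" "simple_root P \<rho>"
proof -
  have root: "poly P x $ 0 = 0" and simple: "poly (pderiv P) x $ 0 \<noteq> 0" if "x $ 0 = r" for x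
    using assms that unfolding simple_root_def
    by (simp_all flip: fps_nth_0_hom.poly_map_poly add: fps_nth_0_hom.map_poly_pderiv)
  obtain x where x: "\<And>n. x n $ 0 = r" "\<And>n. fps_X ^ Suc n dvd poly P (x n)"
    "\<And>n. fps_X ^ Suc n dvd x (Suc n) - x n"
    using hensel_sequence_exists[OF root simple] by blast
  obtain \<rho> where \<rho>: "\<And>n. fps_X ^ Suc n dvd \<rho> - x n"
    using fps_limit_exists[OF x(3)] by blast
  have "fps_X ^ Suc n dvd poly P \<rho>" for n
  proof -
    have "fps_X ^ Suc n dvd (poly P \<rho> - poly P (x n)) + poly P (x n)"
      using \<rho>[of n] diff_dvd_poly_diff[of \<rho> "x n" P] x(2)[of n] by (intro dvd_add) (rule dvd_trans)
    then show ?thesis by simp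
  qed
  then have "poly P \<rho> $ n = 0" for n
    unfolding fps_X_power_dvd_iff by blast
  then have "poly P \<rho> = 0" by (intro fps_ext) simp
  moreover have "\<forall>k<Suc 0. (\<rho> - x 0) $ k = 0"
    using \<rho>[of 0] by (simp only: fps_X_power_dvd_iff)
  then have "\<rho> $ 0 = r" using x(1)[of 0] by simp
  moreover from this have "poly (pderiv P) \<rho> \<noteq> 0" using simple[of \<rho>] by auto
  ultimately show ?thesis using that by (simp add: simple_root_def)
qed

section \<open>Approximating a neighbourhood basis by finite sets\<close>

definition henselian_poly :: "'b::idom list \<Rightarrow> 'b poly" where
  "henselian_poly c = Poly (c @ [1, 1])"

text \<open>
  The equations that elements of a neighbourhood \<open>Y\<close> of \<open>0\<close> have to solve when their parameters come
  from a smaller neighbourhood \<open>X\<close>. Field operations are cast as polynomial equations as well, so that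
  Hensel's lemma treats all of them alike.
\<close>

datatype 'b hensel_equation =
    Sum_Eq 'b 'b
  | Prod_Eq 'b 'b
  | Uminus_Eq 'b
  | Scale_Eq nat 'b
  | Quasi_Inverse_Eq 'b
  | Henselian_Eq "'b list"

primrec equation_level :: "'b hensel_equation \<Rightarrow> nat" where
  "equation_level (Sum_Eq x y) = 0"
| "equation_level (Prod_Eq x y) = 0"
| "equation_level (Uminus_Eq x) = 0"
| "equation_level (Scale_Eq j x) = j"
| "equation_level (Quasi_Inverse_Eq x) = 0"
| "equation_level (Henselian_Eq c) = length c - 1"

primrec equation_poly :: "(nat \<Rightarrow> 'b) \<Rightarrow> 'b hensel_equation \<Rightarrow> 'b::idom poly" where
  "equation_poly en (Sum_Eq x y) = [:- x - y, 1:]"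
| "equation_poly en (Prod_Eq x y) = [:- (x * y), 1:]"
| "equation_poly en (Uminus_Eq x) = [:x, 1:]"
| "equation_poly en (Scale_Eq j x) = [:- (en j * x), 1:]"
| "equation_poly en (Quasi_Inverse_Eq x) = [:x, 1 + x:]"
| "equation_poly en (Henselian_Eq c) = pcompose (henselian_poly c) [:- 1, 1:]"

definition hensel_equations :: "nat \<Rightarrow> 'b set \<Rightarrow> 'b hensel_equation set" where
  "hensel_equations k X = {E. set_hensel_equation E \<subseteq> X \<and> equation_level E \<le> k}"

lemma finite_set_hensel_equation: "finite (set_hensel_equation E)"
  by (cases E) simp_all

lemma finite_hensel_equations:
  assumes "finite X"
  shows "finite (hensel_equations k X)"
proof -
  let ?C = "{c. set c \<subseteq> X \<and> length c \<le> Suc k}"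
  have "hensel_equations k X \<subseteq>
      (\<lambda>(x, y). Sum_Eq x y) ` (X \<times> X) \<union> (\<lambda>(x, y). Prod_Eq x y) ` (X \<times> X) \<union> Uminus_Eq ` X \<union>
      (\<lambda>(j, x). Scale_Eq j x) ` ({..k} \<times> X) \<union> Quasi_Inverse_Eq ` X \<union> Henselian_Eq ` ?C"
  proof
    fix E assume "E \<in> hensel_equations k X"
    then show "E \<in> (\<lambda>(x, y). Sum_Eq x y) ` (X \<times> X) \<union> (\<lambda>(x, y). Prod_Eq x y) ` (X \<times> X) \<union> Uminus_Eq ` X \<union>
        (\<lambda>(j, x). Scale_Eq j x) ` ({..k} \<times> X) \<union> Quasi_Inverse_Eq ` X \<union> Henselian_Eq ` ?C"
      by (cases E) (auto simp: hensel_equations_def)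
  qed
  moreover have "finite ?C"
    using assms by (rule finite_lists_length_le)
  ultimately show ?thesis
    using assms by (elim finite_subset) auto
qed

lemma hensel_equations_image: "hensel_equations k (f ` X) = map_hensel_equation f ` hensel_equations k X"
proof
  have level: "equation_level (map_hensel_equation g E) = equation_level E" for g :: "'x \<Rightarrow> 'y" and E
    by (cases E) simp_all
  show "hensel_equations k (f ` X) \<subseteq> map_hensel_equation f ` hensel_equations k X"
  proof
    fix E assume E: "E \<in> hensel_equations k (f ` X)"
    define D where "D = map_hensel_equation (inv_into X f) E"
    have "map_hensel_equation f D = map_hensel_equation id E"
      unfolding D_def hensel_equation.map_comp using E
      by (intro hensel_equation.map_cong) (auto simp: hensel_equations_def f_inv_into_f)
    then have "E = map_hensel_equation f D" by (simp add: hensel_equation.map_id)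
    moreover have "D \<in> hensel_equations k X"
      using E by (auto simp: D_def hensel_equations_def level hensel_equation.set_map inv_into_into)
    ultimately show "E \<in> map_hensel_equation f ` hensel_equations k X" by blast
  qed
  show "map_hensel_equation f ` hensel_equations k X \<subseteq> hensel_equations k (f ` X)"
    by (rule image_subsetI) (simp add: hensel_equations_def level hensel_equation.set_map image_mono)
qed

lemma coeff_henselian_poly_in: "coeff (henselian_poly c) i \<in> set c \<union> {0, 1}"
proof (cases "i < length (c @ [1, 1])")
  case True
  then have "(c @ [1, 1]) ! i \<in> set (c @ [1, 1])" by (rule nth_mem)
  with True show ?thesis by (simp add: henselian_poly_def coeff_Poly_eq nth_default_nth)
qed (simp add: henselian_poly_def coeff_Poly_eq nth_default_beyond)

lemma coeff_equation_poly_in_subring: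
  assumes R: "is_subring R" and E: "set_hensel_equation E \<subseteq> R" and en: "\<And>j. en j \<in> R"
  shows "coeff (equation_poly en E) i \<in> R"
proof -
  note ring = is_subring_0[OF R] is_subring_1[OF R] is_subring_uminus[OF R] is_subring_add[OF R]
    is_subring_mult[OF R] is_subring_diff[OF R]
  show ?thesis
  proof (cases E)
    case (Henselian_Eq c)
    have "coeff (henselian_poly c) j \<in> R" for j
      using E ring(1,2) coeff_henselian_poly_in[of c j] by (auto simp: Henselian_Eq)
    then show ?thesis
      using ring(1-3)
      by (auto simp: Henselian_Eq coeff_pCons intro!: is_subring_coeff_pcompose[OF R] split: nat.splits)
  qed (use E en ring in \<open>auto simp: coeff_pCons split: nat.splits\<close>)
qed

context specialization
begin

lemma zero: "\<phi> 0 = 0" and one: "\<phi> 1 = 1"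
  using const[of 0] const[of 1] by simp_all

lemma uminus: "x \<in> B \<Longrightarrow> \<phi> (- x) = - \<phi> x"
  using diff[of 0 x] is_subring_0[OF subring] by (simp add: zero)

lemma add: "x \<in> B \<Longrightarrow> y \<in> B \<Longrightarrow> \<phi> (x + y) = \<phi> x + \<phi> y"
  using diff[of x "- y"] is_subring_uminus[OF subring] by (simp add: uminus)

lemma sum: "(\<And>i. i \<in> I \<Longrightarrow> f i \<in> B) \<Longrightarrow> \<phi> (sum f I) = (\<Sum>i\<in>I. \<phi> (f i))"
  by (induction I rule: infinite_finite_induct)
     (simp_all add: zero add is_subring_sum[OF subring])

lemma poly:
  assumes "\<And>i. coeff P i \<in> B" "x \<in> B"
  shows "\<phi> (poly P x) = poly (map_poly \<phi> P) (\<phi> x)"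
  using assms(1)
proof (induction P)
  case 0
  then show ?case by (simp add: zero)
next
  case (pCons a P)
  have "a \<in> B" and P: "\<And>i. coeff P i \<in> B"
    using pCons.prems[of 0] pCons.prems[of "Suc _"] by simp_all
  moreover have "poly P x \<in> B"
    using P assms(2) by (rule is_subring_poly[OF subring])
  ultimately show ?case
    using assms(2)
    by (simp add: Polynomial.map_poly_pCons zero pCons.IH add mult is_subring_mult[OF subring])
qed

lemma map_poly_pderiv:
  assumes "\<And>i. coeff P i \<in> B"
  shows "map_poly \<phi> (pderiv P) = pderiv (map_poly \<phi> P)"
proof (rule poly_eqI)
  fix i
  have "\<phi> (of_nat (Suc i)) = of_nat (Suc i)"
    using const[of "of_nat (Suc i)"] by (simp add: fps_of_nat del: of_nat_Suc)
  then show "coeff (map_poly \<phi> (pderiv P)) i = coeff (pderiv (map_poly \<phi> P)) i"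
    using assms by (simp add: coeff_map_poly zero coeff_pderiv mult is_subring_of_nat[OF subring]
        del: of_nat_Suc)
qed

lemma map_poly_pcompose:
  assumes P: "\<And>i. coeff P i \<in> B" and Q: "\<And>i. coeff Q i \<in> B"
  shows "map_poly \<phi> (pcompose P Q) = pcompose (map_poly \<phi> P) (map_poly \<phi> Q)"
  using P
proof (induction P)
  case 0
  then show ?case by simp
next
  case (pCons a P)
  have a: "a \<in> B" and P: "\<And>i. coeff P i \<in> B"
    using pCons.prems[of 0] pCons.prems[of "Suc _"] by simp_all
  have PQ: "coeff (pcompose P Q) i \<in> B" for i
    using P Q by (rule is_subring_coeff_pcompose[OF subring])
  have "map_poly \<phi> ([:a:] + Q * pcompose P Q) = [:\<phi> a:] + map_poly \<phi> Q * map_poly \<phi> (pcompose P Q)"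
  proof (rule poly_eqI)
    fix i
    have "\<phi> (coeff (Q * pcompose P Q) i) = coeff (map_poly \<phi> Q * map_poly \<phi> (pcompose P Q)) i"
      using Q PQ by (simp add: coeff_mult coeff_map_poly zero sum mult is_subring_mult[OF subring])
    moreover have "coeff (Q * pcompose P Q) i \<in> B"
      using is_subring_mult[OF is_subring_polys[OF subring]] Q PQ by blast
    ultimately show "coeff (map_poly \<phi> ([:a:] + Q * pcompose P Q)) i =
        coeff ([:\<phi> a:] + map_poly \<phi> Q * map_poly \<phi> (pcompose P Q)) i"
      using a is_subring_0[OF subring]
      by (cases i) (simp_all add: coeff_map_poly zero add del: mult_poly_0_left mult_poly_0_right)
  qed
  then show ?case
    using pCons.IH[OF P] by (simp add: pcompose_pCons Polynomial.map_poly_pCons zero)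
qed

lemma map_poly_henselian_poly: "map_poly \<phi> (henselian_poly c) = henselian_poly (map \<phi> c)"
proof (rule poly_eqI)
  fix i
  have "\<phi> (nth_default 0 (c @ [1, 1]) i) = nth_default (\<phi> 0) (map \<phi> (c @ [1, 1])) i"
    by (rule nth_default_map_eq[symmetric]) simp
  then show "coeff (map_poly \<phi> (henselian_poly c)) i = coeff (henselian_poly (map \<phi> c)) i"
    by (simp add: henselian_poly_def coeff_map_poly zero one coeff_Poly_eq)
qed

lemma map_poly_equation_poly:
  assumes E: "set_hensel_equation E \<subseteq> B"
  shows "map_poly \<phi> (equation_poly (\<lambda>j. fps_const (en j)) E) = equation_poly en (map_hensel_equation \<phi> E)"
proof -
  note ring = is_subring_0[OF subring] is_subring_1[OF subring] is_subring_uminus[OF subring]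
    is_subring_mult[OF subring] const_in
  note hom = Polynomial.map_poly_pCons zero one uminus add diff mult const
  show ?thesis
  proof (cases E)
    case (Henselian_Eq c)
    have "coeff (henselian_poly c) i \<in> B" for i
      using E ring(1,2) coeff_henselian_poly_in[of c i] by (auto simp: Henselian_Eq)
    then have "map_poly \<phi> (pcompose (henselian_poly c) [:- 1, 1:]) =
        pcompose (map_poly \<phi> (henselian_poly c)) (map_poly \<phi> [:- 1, 1:])"
      using ring(1-3) by (intro map_poly_pcompose) (auto simp: coeff_pCons split: nat.splits)
    then show ?thesis
      using ring by (simp add: Henselian_Eq map_poly_henselian_poly hom)
  qed (use E ring in \<open>simp_all add: hom\<close>)
qed

end

definition hensel_step :: "(nat \<Rightarrow> 'b::idom) \<Rightarrow> nat \<Rightarrow> 'b set \<Rightarrow> 'b set \<Rightarrow> bool" where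
  "hensel_step en k X Y \<longleftrightarrow> 0 \<in> X \<and> (\<forall>E\<in>hensel_equations k X. \<exists>y\<in>Y. simple_root (equation_poly en E) y)"

lemma hensel_step_closed:
  assumes "hensel_step en k X Y"
  shows hensel_step_0: "0 \<in> X"
    and hensel_step_subset: "X \<subseteq> Y"
    and hensel_step_add: "x \<in> X \<Longrightarrow> y \<in> X \<Longrightarrow> x + y \<in> Y"
    and hensel_step_mult: "x \<in> X \<Longrightarrow> y \<in> X \<Longrightarrow> x * y \<in> Y"
    and hensel_step_uminus: "x \<in> X \<Longrightarrow> - x \<in> Y"
    and hensel_step_scale: "x \<in> X \<Longrightarrow> j \<le> k \<Longrightarrow> en j * x \<in> Y"
    and hensel_step_quasi_inverse: "x \<in> X \<Longrightarrow> \<exists>y\<in>Y. (1 + x) * (1 + y) = 1"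
    and hensel_step_henselian: "set c \<subseteq> X \<Longrightarrow> length c \<le> Suc k \<Longrightarrow> \<exists>y\<in>Y. poly (henselian_poly c) (- 1 + y) = 0"
proof -
  have root: "\<exists>y\<in>Y. simple_root (equation_poly en E) y" if "set_hensel_equation E \<subseteq> X" "equation_level E \<le> k" for E
    using assms that unfolding hensel_step_def hensel_equations_def by blast
  show zero: "0 \<in> X" using assms unfolding hensel_step_def by blast
  show add: "x + y \<in> Y" if "x \<in> X" "y \<in> X" for x y
    using root[of "Sum_Eq x y"] that by (auto simp: algebra_simps)
  show "X \<subseteq> Y" using add[OF _ zero] by auto
  show "x * y \<in> Y" if "x \<in> X" "y \<in> X"
    using root[of "Prod_Eq x y"] that by (auto simp: add_eq_0_iff)
  show "- x \<in> Y" if "x \<in> X"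
    using root[of "Uminus_Eq x"] that by (auto simp: add_eq_0_iff)
  show "en j * x \<in> Y" if "x \<in> X" "j \<le> k"
    using root[of "Scale_Eq j x"] that by (auto simp: add_eq_0_iff)
  show "\<exists>y\<in>Y. (1 + x) * (1 + y) = 1" if "x \<in> X"
    using root[of "Quasi_Inverse_Eq x"] that by (auto simp: algebra_simps)
  show "\<exists>y\<in>Y. poly (henselian_poly c) (- 1 + y) = 0" if "set c \<subseteq> X" "length c \<le> Suc k"
    using root[of "Henselian_Eq c"] that by (auto simp: simple_root_def poly_pcompose le_diff_conv)
qed

lemma simple_root_henselian_poly_replicate_0: "simple_root (henselian_poly (replicate n 0)) (- 1)"
proof -
  have "henselian_poly (replicate n 0) = monom 1 n * [:1, 1 :: 'a:]"
    by (induction n) (simp_all add: henselian_poly_def monom_Suc)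
  then show ?thesis
    by (simp add: simple_root_def pderiv_mult pderiv_pCons poly_monom del: mult_pCons_right)
qed

lemma hensel_step_trivial:
  assumes "0 \<in> Y"
  shows "hensel_step en k {0} Y"
proof -
  have "simple_root (equation_poly en E) 0" if E: "set_hensel_equation E \<subseteq> {0}" for E
  proof (cases E)
    case (Henselian_Eq c)
    then have "c = replicate (length c) 0"
      using E by (simp add: replicate_length_same subset_iff)
    then have "simple_root (henselian_poly c) (- 1)"
      by (metis simple_root_henselian_poly_replicate_0)
    then show ?thesis
      by (simp add: Henselian_Eq simple_root_def poly_pcompose pderiv_pcompose pderiv_pCons)
  qed (use E in auto)
  then show ?thesis
    using assms unfolding hensel_step_def hensel_equations_def by blast
qed

lemma specialization_nth_0: "specialization UNIV (\<lambda>x. x $ 0)"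
  by unfold_locales (simp_all add: is_subring_def)

lemma algebraic_over_fps_const: "series.algebraic_over (fps_const a)"
  using series.algebraic_over_hom[of "[:a:]"] by (simp add: fps_of_poly_const)

lemma algebraic_over_coeff_equation_poly:
  assumes "\<And>x. x \<in> set_hensel_equation E \<Longrightarrow> series.algebraic_over x"
  shows "series.algebraic_over (coeff (equation_poly (\<lambda>j. fps_const (en j)) E) i)"
proof -
  have "coeff (equation_poly (\<lambda>j. fps_const (en j)) E) i \<in> {x. series.algebraic_over x}"
    using assms algebraic_over_fps_const
    by (intro coeff_equation_poly_in_subring[OF series.is_subring_algebraic_over]) auto
  then show ?thesis by simp
qed

lemma lift_simple_root:
  fixes en :: "nat \<Rightarrow> 'a::field"
  defines "p \<equiv> equation_poly (\<lambda>j. fps_const (en j))"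
  assumes E: "\<And>x. x \<in> set_hensel_equation E \<Longrightarrow> series.algebraic_over x"
    and r: "simple_root (equation_poly en (map_hensel_equation (\<lambda>x. x $ 0) E)) r"
  obtains y where "simple_root (p E) y" "series.algebraic_over y" "y $ 0 = r"
proof -
  interpret nth_0: specialization UNIV "\<lambda>x :: 'a fps. x $ 0" by (rule specialization_nth_0)
  have "simple_root (map_poly (\<lambda>x. x $ 0) (p E)) r"
    using r by (simp add: p_def nth_0.map_poly_equation_poly)
  then obtain y where y: "y $ 0 = r" "simple_root (p E) y"
    by (rule fps_hensel)
  then have "p E \<noteq> 0" "poly (p E) y = 0"
    by (auto simp: simple_root_def)
  then have "series.algebraic_over y"
    using series.algebraic_over_root algebraic_over_coeff_equation_poly[OF E] unfolding p_def by blast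
  with y that show ?thesis by blast
qed

definition algebraic_lift :: "'a::field set \<Rightarrow> 'a fps set \<Rightarrow> bool" where
  "algebraic_lift V G \<longleftrightarrow> finite G \<and> (\<forall>x\<in>G. series.algebraic_over x \<and> x $ 0 \<in> V) \<and> fps_const ` V \<subseteq> G"

lemma hensel_step_lift:
  fixes en :: "nat \<Rightarrow> 'a::field"
  assumes step: "hensel_step en k V W" and "finite W" and X: "algebraic_lift V X"
  obtains Y where "algebraic_lift W Y" "hensel_step (\<lambda>j. fps_const (en j)) k X Y"
proof -
  let ?p = "equation_poly (\<lambda>j. fps_const (en j))"
  have "\<exists>y. simple_root (?p E) y \<and> series.algebraic_over y \<and> y $ 0 \<in> W"
    if E: "E \<in> hensel_equations k X" for E
  proof -
    have "map_hensel_equation (\<lambda>x. x $ 0) E \<in> hensel_equations k ((\<lambda>x. x $ 0) ` X)"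
      using E by (simp add: hensel_equations_image)
    moreover have "(\<lambda>x. x $ 0) ` X \<subseteq> V"
      using X by (auto simp: algebraic_lift_def)
    ultimately have "map_hensel_equation (\<lambda>x. x $ 0) E \<in> hensel_equations k V"
      unfolding hensel_equations_def by blast
    then obtain r where r: "r \<in> W" "simple_root (equation_poly en (map_hensel_equation (\<lambda>x. x $ 0) E)) r"
      using step unfolding hensel_step_def by blast
    have "series.algebraic_over x" if "x \<in> set_hensel_equation E" for x
      using that E X by (auto simp: hensel_equations_def algebraic_lift_def)
    from lift_simple_root[OF this r(2)] show ?thesis using r(1) by metis
  qed
  then obtain root where root: "\<And>E. E \<in> hensel_equations k X \<Longrightarrow>
      simple_root (?p E) (root E) \<and> series.algebraic_over (root E) \<and> root E $ 0 \<in> W"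
    by metis
  define Y where "Y = fps_const ` W \<union> root ` hensel_equations k X"
  have "finite (hensel_equations k X)"
    using X by (intro finite_hensel_equations) (simp add: algebraic_lift_def)
  then have "algebraic_lift W Y"
    using \<open>finite W\<close> root algebraic_over_fps_const by (auto simp: algebraic_lift_def Y_def)
  moreover have "0 \<in> X"
    using X hensel_step_0[OF step] by (force simp: algebraic_lift_def)
  then have "hensel_step (\<lambda>j. fps_const (en j)) k X Y"
    using root by (auto simp: hensel_step_def Y_def)
  ultimately show ?thesis using that by blast
qed

lemma (in specialization) hensel_step_specialize:
  assumes step: "hensel_step (\<lambda>j. fps_const (en j)) k X Y" and Y: "Y \<subseteq> B"
    and nonzero: "\<And>E y. E \<in> hensel_equations k X \<Longrightarrow> y \<in> Y \<Longrightarrow>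
      poly (pderiv (equation_poly (\<lambda>j. fps_const (en j)) E)) y \<noteq> 0 \<Longrightarrow>
      \<phi> (poly (pderiv (equation_poly (\<lambda>j. fps_const (en j)) E)) y) \<noteq> 0"
  shows "hensel_step en k (\<phi> ` X) (\<phi> ` Y)"
proof -
  let ?p = "equation_poly (\<lambda>j. fps_const (en j))"
  have X: "X \<subseteq> B" using hensel_step_subset[OF step] Y by blast
  have "\<exists>y\<in>\<phi> ` Y. simple_root (equation_poly en (map_hensel_equation \<phi> E)) y"
    if E: "E \<in> hensel_equations k X" for E
  proof -
    obtain y where y: "y \<in> Y" "simple_root (?p E) y"
      using step E unfolding hensel_step_def by blast
    have params: "set_hensel_equation E \<subseteq> B"
      using E X by (auto simp: hensel_equations_def)
    have coeffs: "coeff (?p E) i \<in> B" for i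
      by (rule coeff_equation_poly_in_subring[OF subring params const_in])
    have "y \<in> B" using y(1) Y by blast
    have "\<phi> (poly (?p E) y) = poly (map_poly \<phi> (?p E)) (\<phi> y)"
      using coeffs \<open>y \<in> B\<close> by (rule poly)
    moreover have "\<phi> (poly (pderiv (?p E)) y) = poly (pderiv (map_poly \<phi> (?p E))) (\<phi> y)"
      using coeffs \<open>y \<in> B\<close> is_subring_coeff_pderiv[OF subring]
      by (simp add: poly flip: map_poly_pderiv)
    ultimately have "simple_root (map_poly \<phi> (?p E)) (\<phi> y)"
      using nonzero[OF E y(1)] y(2) by (simp add: simple_root_def zero)
    then show ?thesis
      using y(1) unfolding map_poly_equation_poly[OF params] by blast
  qed
  moreover have "0 \<in> \<phi> ` X"
    using hensel_step_0[OF step] zero by force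
  ultimately show ?thesis
    by (auto simp: hensel_step_def hensel_equations_image)
qed

definition finite_approximation :: "(nat \<Rightarrow> 'a::field) \<Rightarrow> (nat \<Rightarrow> 'a set) \<Rightarrow> bool" where
  "finite_approximation en V \<longleftrightarrow> (\<forall>k. finite (V k)) \<and> (\<forall>k. hensel_step en k (V (Suc k)) (V k)) \<and>
     1 \<notin> V 0 \<and> (\<exists>M. \<forall>k>M. V k = {0})"

lemma hensel_steps_antimono:
  assumes "\<And>k. hensel_step en k (V (Suc k)) (V k)" "k \<le> l"
  shows "V l \<subseteq> V k"
  using assms(2) by (induction l rule: dec_induct) (use hensel_step_subset[OF assms(1)] in auto)

lemma backward_dependent_choice:
  fixes M :: nat
  assumes "P M x" "\<And>k x. k < M \<Longrightarrow> P (Suc k) x \<Longrightarrow> \<exists>y. P k y \<and> Q k x y"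
  obtains G where "G M = x" "\<And>k. k \<le> M \<Longrightarrow> P k (G k)" "\<And>k. k < M \<Longrightarrow> Q k (G (Suc k)) (G k)"
proof -
  have "\<exists>G. G M = x \<and> (\<forall>k\<le>M. P k (G k)) \<and> (\<forall>k<M. Q k (G (Suc k)) (G k))"
    using assms
  proof (induction M arbitrary: x)
    case 0
    then show ?case by (intro exI[of _ "\<lambda>_. x"]) simp
  next
    case (Suc M)
    then obtain y where y: "P M y" "Q M x y" by blast
    obtain G where "G M = y" "\<forall>k\<le>M. P k (G k)" "\<forall>k<M. Q k (G (Suc k)) (G k)"
      using Suc.IH[OF y(1)] Suc.prems(2) less_SucI by blast
    with y(2) Suc.prems(1) show ?case
      by (intro exI[of _ "G(Suc M := x)"]) (auto simp: le_Suc_eq less_Suc_eq)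
  qed
  then show ?thesis using that by blast
qed

lemma formal_approximation_exists:
  fixes en :: "nat \<Rightarrow> 'a::field"
  assumes "finite_approximation en V"
  obtains G where "fps_X \<in> G M" "\<And>k. k \<le> M \<Longrightarrow> algebraic_lift (V k) (G k)"
    "\<And>k. k < M \<Longrightarrow> hensel_step (\<lambda>j. fps_const (en j)) k (G (Suc k)) (G k)"
proof -
  have V: "finite (V k)" "hensel_step en k (V (Suc k)) (V k)" "0 \<in> V k" for k
    using assms hensel_step_0 hensel_step_subset unfolding finite_approximation_def by blast+
  have "series.algebraic_over fps_X"
    using series.algebraic_over_hom[of "[:0, 1:]"] by simp
  then have "algebraic_lift (V M) (insert fps_X (fps_const ` V M))"
    using V(1,3) algebraic_over_fps_const by (auto simp: algebraic_lift_def)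
  moreover have "\<exists>Y. algebraic_lift (V k) Y \<and> hensel_step (\<lambda>j. fps_const (en j)) k X Y"
    if "algebraic_lift (V (Suc k)) X" for k X
    using hensel_step_lift[OF V(2,1) that] by blast
  ultimately obtain G where "G M = insert fps_X (fps_const ` V M)" "\<And>k. k \<le> M \<Longrightarrow> algebraic_lift (V k) (G k)"
    "\<And>k. k < M \<Longrightarrow> hensel_step (\<lambda>j. fps_const (en j)) k (G (Suc k)) (G k)"
    by (rule backward_dependent_choice[where P = "\<lambda>k. algebraic_lift (V k)"]) blast+
  then show ?thesis using that[of G] by simp
qed

lemma algebraic_over_pderiv_equation_poly:
  assumes "\<And>x. x \<in> set_hensel_equation E \<Longrightarrow> series.algebraic_over x" "series.algebraic_over y"
  shows "series.algebraic_over (poly (pderiv (equation_poly (\<lambda>j. fps_const (en j)) E)) y)"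
proof (rule series.algebraic_over_poly)
  show "series.algebraic_over (coeff (pderiv (equation_poly (\<lambda>j. fps_const (en j)) E)) i)" for i
    using is_subring_coeff_pderiv[OF series.is_subring_algebraic_over]
      algebraic_over_coeff_equation_poly[OF assms(1)] by blast
qed (fact assms(2))

definition nonzero_constraints :: "(nat \<Rightarrow> 'a::field) \<Rightarrow> nat \<Rightarrow> (nat \<Rightarrow> 'a fps set) \<Rightarrow> 'a fps set" where
  "nonzero_constraints en M G = (\<Union>k\<le>M. G k) \<union> (\<lambda>x. x - 1) ` G 0 \<union>
     (\<Union>k<M. \<Union>E\<in>hensel_equations k (G (Suc k)).
        poly (pderiv (equation_poly (\<lambda>j. fps_const (en j)) E)) ` G k)"

lemma nonzero_constraintsI:
  "k \<le> M \<Longrightarrow> x \<in> G k \<Longrightarrow> x \<in> nonzero_constraints en M G"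
  "x \<in> G 0 \<Longrightarrow> x - 1 \<in> nonzero_constraints en M G"
  "k < M \<Longrightarrow> E \<in> hensel_equations k (G (Suc k)) \<Longrightarrow> y \<in> G k \<Longrightarrow>
     poly (pderiv (equation_poly (\<lambda>j. fps_const (en j)) E)) y \<in> nonzero_constraints en M G"
  unfolding nonzero_constraints_def by blast+

lemma finite_nonzero_constraints:
  assumes "\<And>k. k \<le> M \<Longrightarrow> algebraic_lift (V k) (G k)"
  shows "finite (nonzero_constraints en M G)"
  using assms unfolding nonzero_constraints_def algebraic_lift_def by (auto intro!: finite_hensel_equations)

lemma algebraic_over_nonzero_constraints:
  assumes lift: "\<And>k. k \<le> M \<Longrightarrow> algebraic_lift (V k) (G k)" and "x \<in> nonzero_constraints en M G"
  shows "series.algebraic_over x"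
proof -
  note ring = series.is_subring_algebraic_over
  have G: "series.algebraic_over x" if "k \<le> M" "x \<in> G k" for k x
    using lift[OF that(1)] that(2) by (simp add: algebraic_lift_def)
  have "series.algebraic_over (x - 1)" if "x \<in> G 0" for x
    using is_subring_diff[OF ring] is_subring_1[OF ring] G[of 0] that by blast
  moreover have "series.algebraic_over (poly (pderiv (equation_poly (\<lambda>j. fps_const (en j)) E)) y)"
    if "k < M" "E \<in> hensel_equations k (G (Suc k))" "y \<in> G k" for k E y
    using that G[of "Suc k"] G[of k]
    by (intro algebraic_over_pderiv_equation_poly) (auto simp: hensel_equations_def)
  ultimately show ?thesis using assms(2) G unfolding nonzero_constraints_def by blast
qed

lemma finite_approximation_truncate:
  assumes "\<And>k. k \<le> M \<Longrightarrow> finite (V k)" "\<And>k. k < M \<Longrightarrow> hensel_step en k (V (Suc k)) (V k)"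
    "0 \<in> V M" "1 \<notin> V 0"
  shows "finite_approximation en (\<lambda>k. if k \<le> M then V k else {0})"
  unfolding finite_approximation_def
proof (intro conjI allI)
  let ?V = "\<lambda>k. if k \<le> M then V k else {0}"
  show "hensel_step en k (?V (Suc k)) (?V k)" for k
    using assms(2,3) by (cases k M rule: linorder_cases) (auto intro: hensel_step_trivial)
  show "finite (?V k)" for k using assms(1) by simp
  show "1 \<notin> ?V 0" using assms(4) by simp
  show "\<exists>M. \<forall>k>M. ?V k = {0}" by (intro exI[of _ M]) simp
qed

lemma (in specialization) finite_approximation_specialize:
  assumes lift: "\<And>k. k \<le> M \<Longrightarrow> algebraic_lift (V k) (G k)" and V: "0 \<in> V M" "1 \<notin> V 0"
    and step: "\<And>k. k < M \<Longrightarrow> hensel_step (\<lambda>j. fps_const (en j)) k (G (Suc k)) (G k)"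
    and B: "nonzero_constraints en M G \<subseteq> B"
    and nonzero: "\<And>x. x \<in> nonzero_constraints en M G \<Longrightarrow> x \<noteq> 0 \<Longrightarrow> \<phi> x \<noteq> 0"
  shows "finite_approximation en (\<lambda>k. if k \<le> M then \<phi> ` G k else {0})"
proof (rule finite_approximation_truncate)
  have G: "G k \<subseteq> B" if "k \<le> M" for k
    using B nonzero_constraintsI(1)[OF that] by blast
  show "finite (\<phi> ` G k)" if "k \<le> M" for k
    using lift[OF that] by (simp add: algebraic_lift_def)
  show "hensel_step en k (\<phi> ` G (Suc k)) (\<phi> ` G k)" if "k < M" for k
  proof (rule hensel_step_specialize[OF step[OF that]])
    show "G k \<subseteq> B" using G that by simp
  qed (use that in \<open>intro nonzero nonzero_constraintsI(3)\<close>)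
  have "fps_const 0 \<in> G M" using lift[of M] V(1) unfolding algebraic_lift_def by blast
  then show "0 \<in> \<phi> ` G M" using const by force
  show "1 \<notin> \<phi> ` G 0"
  proof
    assume "1 \<in> \<phi> ` G 0"
    then obtain x where x: "x \<in> G 0" "\<phi> x = 1" by auto
    have "x - 1 \<noteq> 0" using lift[of 0] V(2) x(1) by (auto simp: algebraic_lift_def)
    then have "\<phi> (x - 1) \<noteq> 0" using x(1) by (intro nonzero nonzero_constraintsI)
    then show False using x G[of 0] by (auto simp: diff one is_subring_1[OF subring])
  qed
qed

text \<open>
  A new element is adjoined at level \<open>m\<close> by running the closure process with a formal variable in its
  place, and then specialising the resulting finite set of algebraic power series.
\<close>

lemma finite_approximation_extend:
  fixes en :: "nat \<Rightarrow> 'a::field"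
  assumes large: "large_field TYPE('a)" and V: "finite_approximation en V"
  obtains V' x where "finite_approximation en V'" "\<And>k. V k \<subseteq> V' k" "x \<in> V' m" "x \<noteq> 0"
proof -
  have V0: "0 \<in> V k" "1 \<notin> V 0" for k
    using V hensel_step_0 hensel_step_subset unfolding finite_approximation_def by blast+
  obtain M\<^sub>0 where M\<^sub>0: "\<And>k. k > M\<^sub>0 \<Longrightarrow> V k = {0}" using V by (auto simp: finite_approximation_def)
  define M where "M = max m M\<^sub>0"
  obtain G where G: "fps_X \<in> G M" "\<And>k. k \<le> M \<Longrightarrow> algebraic_lift (V k) (G k)"
    "\<And>k. k < M \<Longrightarrow> hensel_step (\<lambda>j. fps_const (en j)) k (G (Suc k)) (G k)"
    using formal_approximation_exists[OF V, of M] by blast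
  let ?S = "nonzero_constraints en M G"
  have "finite ?S"
    using G(2) by (rule finite_nonzero_constraints)
  moreover have "series.algebraic_over x" if "x \<in> ?S" for x
    using G(2) that by (rule algebraic_over_nonzero_constraints)
  ultimately obtain B \<phi> where "specialization B \<phi>"
    and \<phi>: "?S \<subseteq> B" "\<And>x. x \<in> ?S \<Longrightarrow> x \<noteq> 0 \<Longrightarrow> \<phi> x \<noteq> 0"
    using large_field_specialization[OF large] by metis
  interpret specialization B \<phi> by fact
  define V' where "V' k = (if k \<le> M then \<phi> ` G k else {0})" for k
  have V': "finite_approximation en V'"
    unfolding V'_def using finite_approximation_specialize[OF G(2) V0 G(3) \<phi>] .
  moreover have "V k \<subseteq> V' k" for k
  proof (cases "k \<le> M")
    case True
    then have "\<phi> ` fps_const ` V k \<subseteq> V' k"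
      using G(2)[OF True] by (auto simp: V'_def algebraic_lift_def)
    then show ?thesis by (simp add: image_image const)
  next
    case False
    then show ?thesis using M\<^sub>0 by (simp add: V'_def M_def)
  qed
  moreover have "\<phi> fps_X \<in> V' m"
    using G(1) V' hensel_steps_antimono[of en V' m M] by (auto simp: V'_def M_def finite_approximation_def)
  moreover have "\<phi> fps_X \<noteq> 0" using G(1) by (intro \<phi>(2) nonzero_constraintsI) auto
  ultimately show ?thesis using that by blast
qed

lemma finite_subset_incseq_UN:
  fixes V :: "nat \<Rightarrow> 'b set"
  assumes "\<And>i. V i \<subseteq> V (Suc i)" "finite F" "F \<subseteq> (\<Union>i. V i)"
  obtains i where "F \<subseteq> V i"
proof -
  have mono: "V i \<subseteq> V j" if "i \<le> j" for i j
    using assms(1) that by (rule lift_Suc_mono_le)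
  obtain i where i: "\<And>x. x \<in> F \<Longrightarrow> x \<in> V (i x)"
    using assms(3) by (metis UN_E subsetD)
  have "i x \<le> Max (i ` F)" if "x \<in> F" for x
    using that assms(2) by (intro Max_ge) auto
  then have "F \<subseteq> V (Max (i ` F))"
    using i mono by blast
  then show ?thesis by (rule that)
qed

lemma hensel_step_UN:
  fixes X Y :: "nat \<Rightarrow> 'b::idom set"
  assumes step: "\<And>i. hensel_step en k (X i) (Y i)" and incr: "\<And>i. X i \<subseteq> X (Suc i)"
  shows "hensel_step en k (\<Union>i. X i) (\<Union>i. Y i)"
  unfolding hensel_step_def
proof (intro conjI ballI)
  show "0 \<in> (\<Union>i. X i)" using hensel_step_0[OF step] by blast
  fix E assume E: "E \<in> hensel_equations k (\<Union>i. X i)"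
  obtain i where "set_hensel_equation E \<subseteq> X i"
    by (rule finite_subset_incseq_UN[where V = X, OF incr finite_set_hensel_equation[of E]])
       (use E in \<open>auto simp: hensel_equations_def\<close>)
  with E have "E \<in> hensel_equations k (X i)"
    by (simp add: hensel_equations_def)
  then show "\<exists>y\<in>\<Union>i. Y i. simple_root (equation_poly en E) y"
    using step[of i] unfolding hensel_step_def by blast
qed

locale hensel_filtration =
  fixes en :: "nat \<Rightarrow> 'a::field" and U :: "nat \<Rightarrow> 'a set"
  assumes step: "hensel_step en k (U (Suc k)) (U k)"
    and surj: "surj en"
    and one_notin: "1 \<notin> U 0"
    and nontrivial: "\<exists>x\<in>U k. x \<noteq> 0"

theorem hensel_filtration_exists:
  fixes en :: "nat \<Rightarrow> 'a::field"
  assumes large: "large_field TYPE('a)" and "surj en"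
  obtains U where "hensel_filtration en U"
proof -
  have "\<exists>V. \<forall>i. finite_approximation en (V i) \<and> ((\<forall>k. V i k \<subseteq> V (Suc i) k) \<and> (\<exists>x\<in>V (Suc i) i. x \<noteq> 0))"
  proof (intro dependent_nat_choice)
    show "\<exists>V. finite_approximation en V"
      by (intro exI[of _ "\<lambda>_. {0}"]) (auto simp: finite_approximation_def hensel_step_trivial)
  next
    fix V i assume "finite_approximation en V"
    then show "\<exists>V'. finite_approximation en V' \<and> ((\<forall>k. V k \<subseteq> V' k) \<and> (\<exists>x\<in>V' i. x \<noteq> 0))"
      using finite_approximation_extend[OF large, of en V i] by metis
  qed
  then obtain V where V: "\<And>i. finite_approximation en (V i)" "\<And>i k. V i k \<subseteq> V (Suc i) k"
    "\<And>i. \<exists>x\<in>V (Suc i) i. x \<noteq> 0" by blast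
  have "hensel_filtration en (\<lambda>k. \<Union>i. V i k)"
  proof
    fix k
    have "hensel_step en k (V i (Suc k)) (V i k)" for i
      using V(1) by (simp add: finite_approximation_def)
    then show "hensel_step en k (\<Union>i. V i (Suc k)) (\<Union>i. V i k)"
      using V(2) by (rule hensel_step_UN)
    show "1 \<notin> (\<Union>i. V i 0)" using V(1) by (auto simp: finite_approximation_def)
    show "\<exists>x\<in>\<Union>i. V i k. x \<noteq> 0" using V(3)[of k] by blast
  qed fact
  then show ?thesis by (rule that)
qed

section \<open>The topology of a filtration\<close>

locale group_filtration =
  fixes U :: "nat \<Rightarrow> 'a::ab_group_add set"
  assumes zero_in: "0 \<in> U k"
    and decreasing: "U (Suc k) \<subseteq> U k"
    and add_in: "x \<in> U (Suc k) \<Longrightarrow> y \<in> U (Suc k) \<Longrightarrow> x + y \<in> U k"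
    and uminus_in: "x \<in> U (Suc k) \<Longrightarrow> - x \<in> U k"
begin

lemma antimono: "k \<le> l \<Longrightarrow> U l \<subseteq> U k"
  using decreasing by (rule lift_Suc_antimono_le)

definition filtration_topology :: "'a topology" where
  "filtration_topology = topology (\<lambda>W. \<forall>x\<in>W. \<exists>k. \<forall>u\<in>U k. x + u \<in> W)"

lemma openin_filtration_topology:
  "openin filtration_topology W \<longleftrightarrow> (\<forall>x\<in>W. \<exists>k. \<forall>u\<in>U k. x + u \<in> W)"
proof -
  let ?open = "\<lambda>W. \<forall>x\<in>W. \<exists>k. \<forall>u\<in>U k. x + u \<in> W"
  have "istopology ?open"
    unfolding istopology_def
  proof (intro conjI allI impI ballI)
    fix S T x assume "?open S" "?open T" "x \<in> S \<inter> T"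
    then obtain k l where "\<forall>u\<in>U k. x + u \<in> S" "\<forall>u\<in>U l. x + u \<in> T" by blast
    then have "\<forall>u\<in>U (max k l). x + u \<in> S \<inter> T"
      using antimono[of k "max k l"] antimono[of l "max k l"] by auto
    then show "\<exists>k. \<forall>u\<in>U k. x + u \<in> S \<inter> T" ..
  next
    fix \<K> x assume "\<forall>K\<in>\<K>. ?open K" "x \<in> \<Union>\<K>"
    then show "\<exists>k. \<forall>u\<in>U k. x + u \<in> \<Union>\<K>" by (meson UnionE UnionI)
  qed
  then show ?thesis
    by (simp add: filtration_topology_def topology_inverse')
qed

lemma topspace_filtration_topology [simp]: "topspace filtration_topology = UNIV"
proof -
  have "openin filtration_topology UNIV" by (simp add: openin_filtration_topology)
  then show ?thesis by (metis openin_subset top.extremum_unique)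
qed

lemma is_nbhd_filtration_topology:
  "is_nbhd filtration_topology x N \<longleftrightarrow> (\<exists>k. \<forall>u\<in>U k. x + u \<in> N)"
proof
  assume "is_nbhd filtration_topology x N"
  then show "\<exists>k. \<forall>u\<in>U k. x + u \<in> N"
    unfolding is_nbhd_def openin_filtration_topology by blast
next
  assume N: "\<exists>k. \<forall>u\<in>U k. x + u \<in> N"
  let ?W = "{y. \<exists>m. \<forall>u\<in>U m. y + u \<in> N}"
  have "openin filtration_topology ?W"
    unfolding openin_filtration_topology
  proof
    fix y assume "y \<in> ?W"
    then obtain m where m: "\<And>u. u \<in> U m \<Longrightarrow> y + u \<in> N" by auto
    have "y + u \<in> ?W" if "u \<in> U (Suc m)" for u
      using m add_in that by (intro CollectI exI[of _ "Suc m"]) (simp add: add.assoc)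
    then show "\<exists>k. \<forall>u\<in>U k. y + u \<in> ?W" by blast
  qed
  moreover have "x \<in> ?W" using N by blast
  moreover have "?W \<subseteq> N" using zero_in by force
  ultimately show "is_nbhd filtration_topology x N"
    unfolding is_nbhd_def by blast
qed

lemma open_nbhd_exists:
  obtains W where "openin filtration_topology W" "x \<in> W" "W \<subseteq> (+) x ` U k"
  using is_nbhd_filtration_topology[of x "(+) x ` U k"] unfolding is_nbhd_def by blast

lemma continuous_map_on_openI:
  assumes S: "openin filtration_topology S"
    and f: "\<And>x k. x \<in> S \<Longrightarrow> \<exists>l. \<forall>u\<in>U l. x + u \<in> S \<longrightarrow> f (x + u) - f x \<in> U k"
  shows "continuous_map (subtopology filtration_topology S) filtration_topology f"
  unfolding continuous_map_def
proof (intro conjI allI impI)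
  fix W assume W: "openin filtration_topology W"
  have "openin filtration_topology {x \<in> S. f x \<in> W}"
    unfolding openin_filtration_topology
  proof
    fix x assume x: "x \<in> {x \<in> S. f x \<in> W}"
    obtain k where k: "\<And>u. u \<in> U k \<Longrightarrow> f x + u \<in> W"
      using W x unfolding openin_filtration_topology by blast
    obtain l where l: "\<And>u. u \<in> U l \<Longrightarrow> x + u \<in> S \<Longrightarrow> f (x + u) - f x \<in> U k"
      using f x by blast
    obtain m where m: "\<And>u. u \<in> U m \<Longrightarrow> x + u \<in> S"
      using S x unfolding openin_filtration_topology by blast
    have "f (x + u) \<in> W" if "u \<in> U l" "x + u \<in> S" for u
      using k[OF l[OF that]] by simp
    then have "\<forall>u\<in>U (max l m). x + u \<in> {x \<in> S. f x \<in> W}"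
      using m antimono[of l "max l m"] antimono[of m "max l m"] by auto
    then show "\<exists>k. \<forall>u\<in>U k. x + u \<in> {x \<in> S. f x \<in> W}" ..
  qed
  then show "openin (subtopology filtration_topology S)
      {x \<in> topspace (subtopology filtration_topology S). f x \<in> W}"
    unfolding openin_open_subtopology[OF S] by auto
qed simp

lemma continuous_map_binaryI:
  assumes f: "\<And>x y k. \<exists>l. \<forall>u\<in>U l. \<forall>v\<in>U l. f (x + u) (y + v) - f x y \<in> U k"
  shows "continuous_map (prod_topology filtration_topology filtration_topology) filtration_topology
    (\<lambda>(x, y). f x y)"
  unfolding continuous_map_def
proof (intro conjI allI impI)
  fix W assume W: "openin filtration_topology W"
  have "\<exists>A B. openin filtration_topology A \<and> openin filtration_topology B \<and> x \<in> A \<and> y \<in> B \<and>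
      A \<times> B \<subseteq> {(x, y). f x y \<in> W}" if xy: "f x y \<in> W" for x y
  proof -
    obtain k where k: "\<And>u. u \<in> U k \<Longrightarrow> f x y + u \<in> W"
      using W xy unfolding openin_filtration_topology by blast
    obtain l where l: "\<And>u v. u \<in> U l \<Longrightarrow> v \<in> U l \<Longrightarrow> f (x + u) (y + v) - f x y \<in> U k"
      using f by blast
    obtain A where A: "openin filtration_topology A" "x \<in> A" "A \<subseteq> (+) x ` U l"
      by (rule open_nbhd_exists)
    obtain B where B: "openin filtration_topology B" "y \<in> B" "B \<subseteq> (+) y ` U l"
      by (rule open_nbhd_exists)
    have "f (x + u) (y + v) \<in> W" if "u \<in> U l" "v \<in> U l" for u v
      using k[OF l[OF that]] by simp
    then have "A \<times> B \<subseteq> {(x, y). f x y \<in> W}"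
      using A(3) B(3) by blast
    with A B show ?thesis by blast
  qed
  then show "openin (prod_topology filtration_topology filtration_topology)
      {z \<in> topspace (prod_topology filtration_topology filtration_topology). (\<lambda>(x, y). f x y) z \<in> W}"
    by (simp add: openin_prod_topology_alt case_prod_unfold)
qed simp

lemma continuous_map_add:
  "continuous_map (prod_topology filtration_topology filtration_topology) filtration_topology
    (\<lambda>(x, y). x + y)"
proof (rule continuous_map_binaryI)
  fix x y k
  show "\<exists>l. \<forall>u\<in>U l. \<forall>v\<in>U l. x + u + (y + v) - (x + y) \<in> U k"
    using add_in by (intro exI[of _ "Suc k"]) (simp add: algebra_simps)
qed

lemma continuous_map_uminus: "continuous_map filtration_topology filtration_topology uminus"
proof -
  have "continuous_map (subtopology filtration_topology UNIV) filtration_topology uminus"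
  proof (rule continuous_map_on_openI)
    show "openin filtration_topology UNIV" by (simp add: openin_filtration_topology)
    fix x k
    show "\<exists>l. \<forall>u\<in>U l. x + u \<in> UNIV \<longrightarrow> - (x + u) - - x \<in> U k"
      using uminus_in by (intro exI[of _ "Suc k"]) simp
  qed
  then show ?thesis by simp
qed

lemma Hausdorff_filtration_topology:
  assumes separated: "\<And>x. x \<noteq> 0 \<Longrightarrow> \<exists>k. x \<notin> U k"
  shows "Hausdorff_space filtration_topology"
  unfolding Hausdorff_space_def
proof (intro allI impI)
  fix x y assume "x \<in> topspace filtration_topology \<and> y \<in> topspace filtration_topology \<and> x \<noteq> y"
  then obtain k where k: "x - y \<notin> U k" using separated[of "x - y"] by auto
  let ?l = "Suc (Suc k)"
  obtain A where A: "openin filtration_topology A" "x \<in> A" "A \<subseteq> (+) x ` U ?l"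
    by (rule open_nbhd_exists)
  obtain B where B: "openin filtration_topology B" "y \<in> B" "B \<subseteq> (+) y ` U ?l"
    by (rule open_nbhd_exists)
  have "disjnt A B"
    unfolding disjnt_iff
  proof (intro allI notI)
    fix w assume "w \<in> A \<and> w \<in> B"
    then obtain u v where uv: "u \<in> U ?l" "v \<in> U ?l" "x + u = y + v" using A(3) B(3) by blast
    have "v + - u \<in> U k"
      using uv(1,2) uminus_in decreasing by (intro add_in) auto
    moreover have "x - y = v + - u" using uv(3) by (simp add: algebra_simps)
    ultimately show False using k by simp
  qed
  with A B show "\<exists>A B. openin filtration_topology A \<and> openin filtration_topology B \<and>
      x \<in> A \<and> y \<in> B \<and> disjnt A B" by blast
qed

lemma filtration_topology_not_discrete:
  assumes "\<And>k. \<exists>x\<in>U k. x \<noteq> 0"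
  shows "filtration_topology \<noteq> discrete_topology UNIV"
proof
  assume "filtration_topology = discrete_topology UNIV"
  then have "openin filtration_topology {0}" by simp
  then obtain k where "\<forall>u\<in>U k. u = 0" by (auto simp: openin_filtration_topology)
  with assms show False by blast
qed

end

lemma henselian_poly_map_upt:
  assumes "2 \<le> n"
  shows "henselian_poly (map c [0..<n - 1]) = monom 1 n + monom 1 (n - 1) + (\<Sum>i\<le>n - 2. monom (c i) i)"
proof (rule poly_eqI)
  fix j
  have "coeff (henselian_poly (map c [0..<n - 1])) j =
      (if j < n - 1 then c j else if j = n - 1 \<or> j = n then 1 else 0)"
    using assms
    by (auto simp: henselian_poly_def coeff_Poly_eq nth_default_append nth_default_Cons
        split: nat.splits)
  then show "coeff (henselian_poly (map c [0..<n - 1])) j =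
      coeff (monom 1 n + monom 1 (n - 1) + (\<Sum>i\<le>n - 2. monom (c i) i)) j"
    using assms by (auto simp: coeff_sum)
qed

context hensel_filtration
begin

sublocale group_filtration U
proof
  fix k
  show "0 \<in> U k" "U (Suc k) \<subseteq> U k"
    using hensel_step_0[OF step[of k]] hensel_step_subset[OF step[of k]] by auto
  fix x y assume "x \<in> U (Suc k)" "y \<in> U (Suc k)"
  then show "x + y \<in> U k" "- x \<in> U k"
    using hensel_step_add[OF step] hensel_step_uminus[OF step] by blast+
qed

lemma scale_in: obtains l where "\<And>u. u \<in> U l \<Longrightarrow> x * u \<in> U k"
proof -
  obtain j where j: "x = en j" using surj by (auto simp: surj_def)
  have "x * u \<in> U k" if "u \<in> U (Suc (max j k))" for u
    using hensel_step_scale[OF step that, of j] antimono[of k "max j k"] by (auto simp: j)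
  then show ?thesis by (rule that)
qed

lemma continuous_map_mult:
  "continuous_map (prod_topology filtration_topology filtration_topology) filtration_topology
    (\<lambda>(x, y). x * y)"
proof (rule continuous_map_binaryI)
  fix x y k
  obtain l where l: "\<And>u. u \<in> U l \<Longrightarrow> x * u \<in> U (Suc (Suc k))" by (rule scale_in) blast
  obtain m where m: "\<And>u. u \<in> U m \<Longrightarrow> y * u \<in> U (Suc (Suc k))" by (rule scale_in) blast
  let ?n = "max (max l m) (Suc (Suc k))"
  have "(x + u) * (y + v) - x * y \<in> U k" if "u \<in> U ?n" "v \<in> U ?n" for u v
  proof -
    have "u \<in> U m" "v \<in> U l" "u \<in> U (Suc (Suc k))" "v \<in> U (Suc (Suc k))"
      using that antimono[of _ ?n] by (auto simp: subset_iff)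
    then have "x * v + y * u \<in> U (Suc k)" "u * v \<in> U (Suc k)"
      using l m add_in hensel_step_mult[OF step] by blast+
    then have "x * v + y * u + u * v \<in> U k" by (rule add_in)
    then show ?thesis by (simp add: algebra_simps)
  qed
  then show "\<exists>l. \<forall>u\<in>U l. \<forall>v\<in>U l. (x + u) * (y + v) - x * y \<in> U k" by blast
qed

lemma inverse_perturbation:
  assumes "x \<noteq> 0"
  obtains l where "\<And>u. u \<in> U l \<Longrightarrow> x + u \<noteq> 0 \<and> inverse (x + u) - inverse x \<in> U k"
proof -
  obtain l where l: "\<And>u. u \<in> U l \<Longrightarrow> inverse x * u \<in> U k" by (rule scale_in) blast
  obtain m where m: "\<And>u. u \<in> U m \<Longrightarrow> inverse x * u \<in> U (Suc l)" by (rule scale_in) blast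
  have "x + u \<noteq> 0 \<and> inverse (x + u) - inverse x \<in> U k" if u: "u \<in> U m" for u
  proof -
    define v where "v = inverse x * u"
    obtain y where y: "y \<in> U l" "(1 + v) * (1 + y) = 1"
      using hensel_step_quasi_inverse[OF step m[OF u]] unfolding v_def by blast
    have "x + u = x * (1 + v)" using assms by (simp add: v_def algebra_simps)
    then have "(x + u) * (inverse x + inverse x * y) = x * inverse x * ((1 + v) * (1 + y))"
      by (simp add: algebra_simps)
    then have unit: "(x + u) * (inverse x + inverse x * y) = 1"
      using assms y(2) by simp
    then have "inverse (x + u) = inverse x + inverse x * y" by (rule inverse_unique)
    then show ?thesis using unit l[OF y(1)] by auto
  qed
  then show ?thesis by (rule that)
qed

lemma continuous_map_inverse:
  "continuous_map (subtopology filtration_topology (UNIV - {0})) filtration_topology inverse"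
proof (rule continuous_map_on_openI)
  show "openin filtration_topology (UNIV - {0})"
    unfolding openin_filtration_topology using inverse_perturbation by (metis Diff_iff UNIV_I singleton_iff)
  fix x k assume "x \<in> UNIV - {0 :: 'a}"
  then show "\<exists>l. \<forall>u\<in>U l. x + u \<in> UNIV - {0} \<longrightarrow> inverse (x + u) - inverse x \<in> U k"
    using inverse_perturbation by (metis Diff_iff singleton_iff)
qed

lemma separated:
  assumes "x \<noteq> 0"
  shows "\<exists>k. x \<notin> U k"
proof -
  obtain k where "\<And>u. u \<in> U k \<Longrightarrow> inverse x * u \<in> U 0" by (rule scale_in) blast
  then show ?thesis using one_notin assms by (metis left_inverse)
qed

theorem field_topology_filtration_topology: "field_topology filtration_topology"
  unfolding field_topology_def
  using continuous_map_add continuous_map_uminus continuous_map_mult continuous_map_inverse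
    Hausdorff_filtration_topology[OF separated] filtration_topology_not_discrete[OF nontrivial]
  by simp

theorem gt_henselian_filtration_topology: "gt_henselian filtration_topology"
  unfolding gt_henselian_def
proof (intro allI impI)
  fix n :: nat and N assume n: "2 \<le> n" and "is_nbhd filtration_topology (- 1) N"
  then obtain k where k: "\<And>u. u \<in> U k \<Longrightarrow> - 1 + u \<in> N"
    unfolding is_nbhd_filtration_topology by blast
  let ?k = "max k n"
  have "is_nbhd filtration_topology 0 (U (Suc ?k))"
    unfolding is_nbhd_filtration_topology by auto
  moreover have "\<exists>x\<in>N. poly (monom 1 n + monom 1 (n - 1) + (\<Sum>i\<le>n - 2. monom (c i) i)) x = 0"
    if c: "\<forall>i\<le>n - 2. c i \<in> U (Suc ?k)" for c
  proof -
    have "set (map c [0..<n - 1]) \<subseteq> U (Suc ?k)"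
      using c n by auto
    moreover have "length (map c [0..<n - 1]) \<le> Suc ?k"
      unfolding length_map length_upt by linarith
    ultimately obtain y where y: "y \<in> U ?k" "poly (henselian_poly (map c [0..<n - 1])) (- 1 + y) = 0"
      using hensel_step_henselian[OF step] by blast
    have "- 1 + y \<in> N" using k y(1) antimono[of k ?k] by auto
    then show ?thesis using y(2) unfolding henselian_poly_map_upt[OF n] by blast
  qed
  ultimately show "\<exists>V. is_nbhd filtration_topology 0 V \<and> (\<forall>c. (\<forall>i\<le>n - 2. c i \<in> V) \<longrightarrow>
      (\<exists>x\<in>N. poly (monom 1 n + monom 1 (n - 1) + (\<Sum>i\<le>n - 2. monom (c i) i)) x = 0))" by blast
qed

end

section \<open>Fields with a gt-henselian topology are large\<close>

context
  fixes \<tau> :: "'a::field topology"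
  assumes \<tau>: "field_topology \<tau>"
begin

lemma topspace_field_topology: "topspace \<tau> = UNIV"
  using \<tau> by (simp add: field_topology_def)

lemma openin_field_topology_cofinite:
  assumes "finite F"
  shows "openin \<tau> (UNIV - F)"
proof -
  have "t1_space \<tau>"
    using \<tau> by (intro Hausdorff_imp_t1_space) (simp add: field_topology_def)
  then have "closedin \<tau> F"
    using assms by (simp add: t1_space_closedin_finite topspace_field_topology)
  then show ?thesis by (simp add: closedin_def topspace_field_topology)
qed

lemma continuous_map_field_add:
  assumes "continuous_map X \<tau> f" "continuous_map X \<tau> g"
  shows "continuous_map X \<tau> (\<lambda>x. f x + g x)"
proof -
  have "continuous_map (prod_topology \<tau> \<tau>) \<tau> (\<lambda>(x, y). x + y)"
    using \<tau> by (simp add: field_topology_def)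
  from continuous_map_compose[OF continuous_map_pairedI[OF assms] this] show ?thesis
    by (simp add: o_def)
qed

lemma continuous_map_field_mult:
  assumes "continuous_map X \<tau> f" "continuous_map X \<tau> g"
  shows "continuous_map X \<tau> (\<lambda>x. f x * g x)"
proof -
  have "continuous_map (prod_topology \<tau> \<tau>) \<tau> (\<lambda>(x, y). x * y)"
    using \<tau> by (simp add: field_topology_def)
  from continuous_map_compose[OF continuous_map_pairedI[OF assms] this] show ?thesis
    by (simp add: o_def)
qed

lemma continuous_map_field_inverse:
  assumes "continuous_map X \<tau> f" "\<And>x. x \<in> topspace X \<Longrightarrow> f x \<noteq> 0"
  shows "continuous_map X \<tau> (\<lambda>x. inverse (f x))"
proof -
  have "continuous_map X (subtopology \<tau> (UNIV - {0})) f"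
    using assms by (simp add: continuous_map_in_subtopology image_subset_iff)
  moreover have "continuous_map (subtopology \<tau> (UNIV - {0})) \<tau> inverse"
    using \<tau> by (simp add: field_topology_def)
  ultimately show ?thesis
    using continuous_map_compose by (fastforce simp: o_def)
qed

lemma continuous_map_field_const: "continuous_map X \<tau> (\<lambda>_. c)"
  by (simp add: topspace_field_topology)

lemma continuous_map_field_power:
  "continuous_map X \<tau> f \<Longrightarrow> continuous_map X \<tau> (\<lambda>x. f x ^ n)"
  by (induction n) (simp_all add: topspace_field_topology continuous_map_field_mult)

lemma continuous_map_field_poly:
  "continuous_map X \<tau> f \<Longrightarrow> continuous_map X \<tau> (\<lambda>x. poly p (f x))"
  by (induction p) (simp_all add: topspace_field_topology continuous_map_field_add continuous_map_field_mult)

lemma infinite_open_field_topology: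
  assumes A: "openin \<tau> A" "a \<in> A"
  shows "infinite A"
proof
  assume "finite A"
  then have "openin \<tau> (A \<inter> (UNIV - (A - {a})))"
    using A(1) openin_field_topology_cofinite by (intro openin_Int) auto
  moreover have "A \<inter> (UNIV - (A - {a})) = {a}" using A(2) by auto
  ultimately have open_a: "openin \<tau> {a}" by simp
  have "openin \<tau> {x}" for x
  proof -
    have "continuous_map \<tau> \<tau> (\<lambda>y. y + (a - x))"
      using continuous_map_field_add[OF continuous_map_id[unfolded id_def] continuous_map_field_const] .
    then have "openin \<tau> {y \<in> topspace \<tau>. y + (a - x) \<in> {a}}"
      using open_a by (rule openin_continuous_map_preimage)
    moreover have "{y \<in> topspace \<tau>. y + (a - x) \<in> {a}} = {x}"
      by (auto simp: topspace_field_topology algebra_simps)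
    ultimately show ?thesis by simp
  qed
  then have "\<tau> = discrete_topology UNIV"
    using topspace_field_topology discrete_topology_unique[of UNIV \<tau>] by auto
  then show False using \<tau> by (simp add: field_topology_def)
qed

end

lemma root_if_normalized_root:
  fixes a :: "nat \<Rightarrow> 'a::field"
  assumes "2 \<le> n" "a 1 \<noteq> 0" "w \<noteq> 0"
    and root: "w ^ n + w ^ (n - 1) + (\<Sum>j\<le>n - 2. a (n - j) * a 0 ^ (n - j - 1) * inverse (a 1) ^ (n - j) * w ^ j) = 0"
  shows "(\<Sum>i\<le>n. a i * (a 0 * inverse (a 1) * inverse w) ^ i) = 0"
proof -
  define e where "e i = a i * a 0 ^ (i - 1) * inverse (a 1) ^ i" for i
  define y where "y = a 0 * inverse (a 1) * inverse w"
  obtain m where m: "n = Suc (Suc m)" using assms(1) by (metis le_Suc_ex add_2_eq_Suc)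
  have summand: "w ^ n * (a (Suc i) * y ^ Suc i) = a 0 * (e (Suc i) * w ^ (n - Suc i))" if "i < n" for i
  proof -
    have "w ^ n = w ^ (n - Suc i) * w ^ Suc i"
      using that by (simp del: power_Suc flip: power_add)
    moreover have "w ^ Suc i * inverse w ^ Suc i = 1"
      using assms(3) by (simp del: power_Suc flip: power_mult_distrib)
    ultimately show ?thesis
      unfolding y_def e_def power_mult_distrib by (simp add: algebra_simps)
  qed
  have "w ^ n * (\<Sum>i\<le>n. a i * y ^ i) = w ^ n * a 0 + (\<Sum>i<n. w ^ n * (a (Suc i) * y ^ Suc i))"
    by (simp add: sum.atMost_shift sum_distrib_left distrib_left)
  also have "(\<Sum>i<n. w ^ n * (a (Suc i) * y ^ Suc i)) = a 0 * (\<Sum>i<n. e (n - (n - Suc i)) * w ^ (n - Suc i))"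
    unfolding sum_distrib_left by (intro sum.cong) (simp_all add: summand del: power_Suc)
  also have "(\<Sum>i<n. e (n - (n - Suc i)) * w ^ (n - Suc i)) = (\<Sum>j<n. e (n - j) * w ^ j)"
    by (rule sum.nat_diff_reindex)
  also have "\<dots> = w ^ (n - 1) + (\<Sum>j\<le>n - 2. e (n - j) * w ^ j)"
    using assms(2) by (simp add: m lessThan_Suc_atMost e_def)
  also have "w ^ n * a 0 + a 0 * (w ^ (n - 1) + (\<Sum>j\<le>n - 2. e (n - j) * w ^ j)) = 0"
    using arg_cong[OF root, of "(*) (a 0)"] by (simp add: e_def algebra_simps)
  finally show ?thesis using assms(3) by (simp add: y_def)
qed

lemma open_nbhd_of_continuous_family:
  assumes S: "openin X S" "x \<in> S" and f: "\<And>j. j \<le> m \<Longrightarrow> continuous_map (subtopology X S) Y (f j)"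
    and V: "openin Y V" "\<And>j. j \<le> m \<Longrightarrow> f j x \<in> V"
  obtains N where "openin X N" "x \<in> N" "N \<subseteq> S" "\<And>j z. j \<le> (m :: nat) \<Longrightarrow> z \<in> N \<Longrightarrow> f j z \<in> V"
proof -
  have "S \<subseteq> topspace X" using S(1) by (rule openin_subset)
  then have "openin X {z \<in> S. f j z \<in> V}" if "j \<le> m" for j
    using openin_continuous_map_preimage[OF f[OF that] V(1)] S(1)
    by (simp add: openin_open_subtopology Int_absorb1)
  then have "openin X (\<Inter>j\<in>{..m}. {z \<in> S. f j z \<in> V})"
    by (intro openin_Inter) auto
  then show ?thesis
    using S(2) V(2) by (intro that[of "\<Inter>j\<in>{..m}. {z \<in> S. f j z \<in> V}"]) auto
qed

lemma gt_henselian_nonzero_root: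
  assumes \<tau>: "field_topology \<tau>" "gt_henselian \<tau>" and n: "2 \<le> n"
  obtains V where "openin \<tau> V" "0 \<in> V" "\<And>c. \<forall>j\<le>n - 2. c j \<in> V \<Longrightarrow>
    \<exists>w. w \<noteq> 0 \<and> w ^ n + w ^ (n - 1) + (\<Sum>j\<le>n - 2. c j * w ^ j) = 0"
proof -
  have "is_nbhd \<tau> (- 1) (UNIV - {0})"
    unfolding is_nbhd_def using openin_field_topology_cofinite[OF \<tau>(1), of "{0}"]
    by (intro exI[of _ "UNIV - {0}"]) auto
  then obtain U where "is_nbhd \<tau> 0 U" and U: "\<And>c. \<forall>j\<le>n - 2. c j \<in> U \<Longrightarrow>
      \<exists>w\<in>UNIV - {0}. poly (monom 1 n + monom 1 (n - 1) + (\<Sum>j\<le>n - 2. monom (c j) j)) w = 0"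
    using \<tau>(2) n unfolding gt_henselian_def by blast
  then obtain V where V: "openin \<tau> V" "0 \<in> V" "V \<subseteq> U" by (auto simp: is_nbhd_def)
  have "\<exists>w. w \<noteq> 0 \<and> w ^ n + w ^ (n - 1) + (\<Sum>j\<le>n - 2. c j * w ^ j) = 0" if "\<forall>j\<le>n - 2. c j \<in> V" for c
    using U[of c] that V(3) by (auto simp: poly_sum poly_monom)
  with V(1,2) show ?thesis by (rule that)
qed

lemma gt_henselian_roots_near_0:
  fixes \<tau> :: "'a::field topology" and a :: "nat \<Rightarrow> 'a poly"
  assumes \<tau>: "field_topology \<tau>" "gt_henselian \<tau>" and n: "2 \<le> n"
    and a: "poly (a 0) 0 = 0" "poly (a 1) 0 \<noteq> 0"
  obtains N where "openin \<tau> N" "0 \<in> N" "\<And>x. x \<in> N \<Longrightarrow> \<exists>y. (\<Sum>i\<le>n. poly (a i) x * y ^ i) = 0"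
proof -
  obtain V where V: "openin \<tau> V" "0 \<in> V" "\<And>c. \<forall>j\<le>n - 2. c j \<in> V \<Longrightarrow>
      \<exists>w. w \<noteq> 0 \<and> w ^ n + w ^ (n - 1) + (\<Sum>j\<le>n - 2. c j * w ^ j) = 0"
    using gt_henselian_nonzero_root[OF \<tau> n] by blast
  define S where "S = {x. poly (a 1) x \<noteq> 0}"
  have "finite {x. poly (a 1) x = 0}" using a(2) by (intro poly_roots_finite) auto
  moreover have "S = UNIV - {x. poly (a 1) x = 0}" by (auto simp: S_def)
  ultimately have S: "openin \<tau> S"
    using openin_field_topology_cofinite[OF \<tau>(1)] by simp
  define c where "c x j = poly (a (n - j)) x * poly (a 0) x ^ (n - j - 1) * inverse (poly (a 1) x) ^ (n - j)"
    for x j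
  have "continuous_map (subtopology \<tau> S) \<tau> (\<lambda>x. x)"
    using continuous_map_id[of \<tau>] by (intro continuous_map_from_subtopology) (simp add: id_def)
  then have continuous: "continuous_map (subtopology \<tau> S) \<tau> (\<lambda>x. c x j)" for j
    unfolding c_def
    by (intro continuous_map_field_mult continuous_map_field_power continuous_map_field_inverse
        continuous_map_field_poly \<tau>(1)) (auto simp: S_def)
  have "0 \<in> S" using a(2) by (simp add: S_def)
  moreover have "c 0 j \<in> V" if "j \<le> n - 2" for j
    using that n V(2) by (simp add: c_def a(1) power_0_left)
  ultimately obtain N where N: "openin \<tau> N" "0 \<in> N" "N \<subseteq> S"
    "\<And>j x. j \<le> n - 2 \<Longrightarrow> x \<in> N \<Longrightarrow> c x j \<in> V"
    using open_nbhd_of_continuous_family[where f = "\<lambda>j x. c x j" and m = "n - 2", OF S _ continuous V(1)]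
    by metis
  have "\<exists>y. (\<Sum>i\<le>n. poly (a i) x * y ^ i) = 0" if x: "x \<in> N" for x
  proof -
    obtain w where "w \<noteq> 0" "w ^ n + w ^ (n - 1) + (\<Sum>j\<le>n - 2. c x j * w ^ j) = 0"
      using V(3)[of "c x"] N(4)[OF _ x] by blast
    moreover have "poly (a 1) x \<noteq> 0" using x N(3) by (auto simp: S_def)
    ultimately show ?thesis
      using root_if_normalized_root[of n "\<lambda>i. poly (a i) x" w] n by (auto simp: c_def)
  qed
  with N(1,2) show ?thesis by (rule that)
qed

theorem gt_henselian_imp_large:
  fixes \<tau> :: "'a::field topology"
  assumes \<tau>: "field_topology \<tau>" "gt_henselian \<tau>"
  shows "large_field TYPE('a)"
  unfolding large_field_def
proof (intro allI impI)
  fix f :: "'a poly poly" assume f: "eval_XY f 0 0 = 0 \<and> eval_XY (pderiv f) 0 0 \<noteq> 0"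
  define n where "n = max 2 (degree f)"
  have eval: "eval_XY f x y = (\<Sum>i\<le>n. poly (coeff f i) x * y ^ i)" for x y
  proof -
    have "poly f [:y:] = poly (\<Sum>i\<le>n. monom (coeff f i) i) [:y:]"
      by (simp add: poly_as_sum_of_monoms' n_def)
    then show ?thesis
      by (simp add: eval_XY_def poly_sum poly_monom)
  qed
  have origin: "eval_XY g 0 0 = poly (coeff g 0) 0" for g :: "'a poly poly"
    by (simp add: eval_XY_def poly_0_coeff_0)
  obtain N where N: "openin \<tau> N" "0 \<in> N"
    "\<And>x. x \<in> N \<Longrightarrow> \<exists>y. (\<Sum>i\<le>n. poly (coeff f i) x * y ^ i) = 0"
    by (rule gt_henselian_roots_near_0[OF \<tau>, of n "coeff f"])
       (use f in \<open>auto simp: n_def origin coeff_pderiv\<close>)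
  then have "N \<subseteq> fst ` {(x, y). eval_XY f x y = 0}"
    unfolding eval by force
  moreover have "infinite N" using N(1,2) by (rule infinite_open_field_topology[OF \<tau>(1)])
  ultimately show "infinite {(x, y). eval_XY f x y = 0}"
    using finite_imageI finite_subset by blast
qed

theorem theorem1p2:
  assumes "countable (UNIV :: 'a::field set)"
  shows "large_field TYPE('a) \<longleftrightarrow> (\<exists>\<tau> :: 'a topology. field_topology \<tau> \<and> gt_henselian \<tau>)"
proof
  assume "large_field TYPE('a)"
  moreover have "surj (from_nat_into (UNIV :: 'a set))"
    using assms by (simp add: range_from_nat_into)
  ultimately obtain U where "hensel_filtration (from_nat_into (UNIV :: 'a set)) U"
    by (rule hensel_filtration_exists)
  then interpret hensel_filtration "from_nat_into (UNIV :: 'a set)" U .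
  show "\<exists>\<tau> :: 'a topology. field_topology \<tau> \<and> gt_henselian \<tau>"
    using field_topology_filtration_topology gt_henselian_filtration_topology by blast
qed (use gt_henselian_imp_large in blast)

end
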